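(* For all integers $n\ge 1$ and $2\le k\le n+1$, the space $D_k(\Delta^n)$ is homotopy equivalent to a wedge of spheres of dimension $n-k+1$.
   Context: $\Delta^n$ is the $n$-dimensional simplex, i.e. the full simplicial complex on the vertex set $[n+1]=\{1,\dots,n+1\}$. The discretized configuration space $D_k(\Delta^n)$ is the largest cell complex (subcomplex of the product cell complex $(\Delta^n)^k$) that is contained in $(\Delta^n)^k$ minus the diagonal $\{(x_1,\dots,x_k)\in(\Delta^n)^k : x_i=x_j \text{ for some } i\neq j\}$. Explicitly, $D_k(\Delta^n)=\bigcup \sigma_1\times\cdots\times\sigma_k\subset(\Delta^n)^k$, where the union is over all $k$-tuples $(\sigma_1,\dots,\sigma_k)$ of open cells (interiors of nonempty faces) of $\Delta^n$ whose closures $\bar\sigma_1,\dots,\bar\sigma_k$ are pairwise disjoint. A wedge of $m$ spheres of dimension $0$ is a discrete space with $m+1$ points. *)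

theory Defs
  imports "HOL-Homology.Simplices"
begin

section \<open>The simplex as a cell complex\<close>

text \<open>The library simplex \<^const>\<open>standard_simplex\<close> has vertex set \<open>{0..n}\<close> instead of \<open>{1..n+1}\<close>.\<close>

definition simplex_space :: "nat \<Rightarrow> (nat \<Rightarrow> real) topology" where
  "simplex_space n = subtopology (powertop_real UNIV) (standard_simplex n)"

definition open_face :: "nat \<Rightarrow> nat set \<Rightarrow> (nat \<Rightarrow> real) set" where
  "open_face n S = {x \<in> standard_simplex n. {i. x i \<noteq> 0} = S}"

definition open_cells :: "nat \<Rightarrow> (nat \<Rightarrow> real) set set" where
  "open_cells n = open_face n ` {S. S \<subseteq> {0..n} \<and> S \<noteq> {}}"

section \<open>The discretized configuration space\<close>

definition discretized_configuration_space :: "nat \<Rightarrow> nat \<Rightarrow> (nat \<Rightarrow> nat \<Rightarrow> real) topology" where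
  "discretized_configuration_space k n =
     subtopology (product_topology (\<lambda>_. simplex_space n) {1..k})
       (\<Union>{\<Pi>\<^sub>E i\<in>{1..k}. \<sigma> i | \<sigma>.
            (\<forall>i\<in>{1..k}. \<sigma> i \<in> open_cells n) \<and>
            pairwise (\<lambda>i j. disjnt (simplex_space n closure_of \<sigma> i)
                                   (simplex_space n closure_of \<sigma> j)) {1..k}})"

section \<open>Wedges of spheres\<close>

definition quotient_topology :: "'a topology \<Rightarrow> ('a \<Rightarrow> 'b) \<Rightarrow> 'b topology" where
  "quotient_topology X q =
     topology (\<lambda>U. U \<subseteq> q ` topspace X \<and> openin X {x \<in> topspace X. q x \<in> U})"

lemma openin_quotient_topology:
  "openin (quotient_topology X q) U \<longleftrightarrow>
     U \<subseteq> q ` topspace X \<and> openin X {x \<in> topspace X. q x \<in> U}"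
proof -
  have "istopology (\<lambda>U. U \<subseteq> q ` topspace X \<and> openin X {x \<in> topspace X. q x \<in> U})"
    unfolding istopology_def
  proof (intro conjI allI impI)
    fix S T assume S: "S \<subseteq> q ` topspace X \<and> openin X {x \<in> topspace X. q x \<in> S}"
      and T: "T \<subseteq> q ` topspace X \<and> openin X {x \<in> topspace X. q x \<in> T}"
    have "{x \<in> topspace X. q x \<in> S \<inter> T} = {x \<in> topspace X. q x \<in> S} \<inter> {x \<in> topspace X. q x \<in> T}"
      by auto
    moreover have "openin X ({x \<in> topspace X. q x \<in> S} \<inter> {x \<in> topspace X. q x \<in> T})"
      using S T by (intro openin_Int) (rule conjunct2, assumption)+
    ultimately show "openin X {x \<in> topspace X. q x \<in> S \<inter> T}" by (rule ssubst)
    show "S \<inter> T \<subseteq> q ` topspace X" using S by blast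
  next
    fix \<K> assume K: "\<forall>K\<in>\<K>. K \<subseteq> q ` topspace X \<and> openin X {x \<in> topspace X. q x \<in> K}"
    have "{x \<in> topspace X. q x \<in> \<Union>\<K>} = (\<Union>K\<in>\<K>. {x \<in> topspace X. q x \<in> K})"
      by auto
    moreover have "openin X (\<Union>K\<in>\<K>. {x \<in> topspace X. q x \<in> K})"
      using K by (intro openin_Union) blast
    ultimately show "openin X {x \<in> topspace X. q x \<in> \<Union>\<K>}" by simp
    show "\<Union>\<K> \<subseteq> q ` topspace X" using K by blast
  qed
  then show ?thesis by (simp add: quotient_topology_def)
qed

lemma topspace_quotient_topology [simp]: "topspace (quotient_topology X q) = q ` topspace X"
proof
  show "topspace (quotient_topology X q) \<subseteq> q ` topspace X"
    using openin_topspace[of "quotient_topology X q"] unfolding openin_quotient_topology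
    by (rule conjunct1)
  have "{x \<in> topspace X. q x \<in> q ` topspace X} = topspace X" by auto
  then have "openin (quotient_topology X q) (q ` topspace X)"
    unfolding openin_quotient_topology by simp
  then show "q ` topspace X \<subseteq> topspace (quotient_topology X q)" by (rule openin_subset)
qed

lemma quotient_map_quotient_topology: "quotient_map X (quotient_topology X q) q"
  unfolding quotient_map_def topspace_quotient_topology openin_quotient_topology by blast

text \<open>The quotient of the disjoint union that identifies all basepoints with each other:
  a point of the wedge is either the set of all basepoints or a singleton.\<close>

definition wedge_sum :: "('i \<Rightarrow> 'a topology) \<Rightarrow> ('i \<Rightarrow> 'a) \<Rightarrow> 'i set \<Rightarrow> ('i \<times> 'a) set topology" where
  "wedge_sum X p I =
     quotient_topology (sum_topology X I)
       (\<lambda>z. if z \<in> (\<lambda>i. (i, p i)) ` I then (\<lambda>i. (i, p i)) ` I else {z})"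

text \<open>The library sphere \<^const>\<open>nsphere\<close> \<open>d\<close> is the unit sphere in the coordinates \<open>0, \<dots>, d\<close>;
  for \<open>d = 0\<close> it consists of two points.\<close>

definition nsphere_basepoint :: "nat \<Rightarrow> real" where
  "nsphere_basepoint = (\<lambda>i. if i = 0 then 1 else 0)"

definition wedge_of_spheres :: "nat \<Rightarrow> nat \<Rightarrow> (nat \<times> (nat \<Rightarrow> real)) set topology" where
  "wedge_of_spheres m d = wedge_sum (\<lambda>_. nsphere d) (\<lambda>_. nsphere_basepoint) {1..m}"

end

theory Submission
  imports Defs
begin

text \<open>
  We write points of the configuration space as matrices \<open>x c j\<close> (colour \<open>c\<close>, vertex \<open>j < N\<close>) whose
  rows have disjoint supports. A set of top-dimensional cells is removed so that the remaining
  subcomplex, the core, is contractible. It contains the whole codimension-one skeleton, so collapsing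
  it produces a wedge of spheres, one for each removed cell.

  The removed cells come from the last vertex: \<open>conf C (N + 1)\<close> is the union, over the colours \<open>c\<close>,
  of the mapping cylinders of the maps \<open>conf C N \<rightarrow> conf (C - {c}) N\<close> that forget the row \<open>c\<close>, glued
  along \<open>conf C N\<close>. The image of such a map consists of configurations that do not use all vertices,
  so it lies in the core of \<open>conf (C - {c}) N\<close>. The core of \<open>conf C (N + 1)\<close> consists of the
  full cylinder over \<open>conf C N\<close> for the smallest colour, and of the cylinders over the core of
  \<open>conf C N\<close> for the other ones, all of them ending in the core of \<open>conf (C - {c}) N\<close>. Each of
  these pieces is contractible and two of them meet in the core of \<open>conf C N\<close>, which is contractible by
  induction.
\<close>

section \<open>Homotopy extension and gluing of contractible sets\<close>

text \<open>An open top cell is given by a surjection from the \<open>N\<close> vertices to the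
  colours; it is a product of open simplices, one for each block, so its dimension is
  \<open>N - card C\<close>. With \<open>N = n + 1\<close> and \<open>k\<close> colours this is the
  dimension in the theorem. The obstacle is that \<open>conf C N\<close> is usually not
  contractible, while all cylinders over it share it as their base. Two full cylinders would meet in
  all of \<open>conf C N\<close>, so only one may stay full, and each of the others must lose what
  lies above the removed cells of the base. The smallest colour is just a canonical choice for the
  full one. Hence, for \<open>card C \<le> N\<close>, the number r of removed cells satisfies r(C, N
  + 1) = (|C| - 1) r(C, N) + (the sum of r(C - {c}, N) over the colours c). The deformations are
  explicit formulas on matrices. Whether they avoid the removed cells is decided by supports alone:
  an open cell is left alone as long as no new positive entry appears, and the only place where one
  may appear is the last vertex in the row that names the cylinder.\<close>

text \<open>The homotopy extension property, as a retraction of the cylinder on \<open>X\<close>.\<close>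

definition hep :: "'a::topological_space set \<Rightarrow> 'a set \<Rightarrow> bool" where
  "hep X A \<longleftrightarrow> A \<subseteq> X \<and>
     (\<exists>r. continuous_on ({0..1::real} \<times> X) r \<and>
          r \<in> {0..1} \<times> X \<rightarrow> {0} \<times> X \<union> {0..1} \<times> A \<and>
          (\<forall>z \<in> {0} \<times> X \<union> {0..1} \<times> A. r z = z))"

text \<open>Extend the retraction for \<open>Q\<close> by the identity over \<open>P\<close>; the
  two agree over \<open>P \<inter> Q\<close> because the retraction fixes that part of the
  cylinder.\<close>

lemma hep_Un:
  assumes "closed P" "closed Q" "hep Q (P \<inter> Q)"
  shows "hep (P \<union> Q) P"
proof -
  obtain r where r: "continuous_on ({0..1::real} \<times> Q) r"
      "r \<in> {0..1} \<times> Q \<rightarrow> {0} \<times> Q \<union> {0..1} \<times> (P \<inter> Q)"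
      and rid: "\<And>z. z \<in> {0} \<times> Q \<union> {0..1} \<times> (P \<inter> Q) \<Longrightarrow> r z = z"
    using assms(3) unfolding hep_def by blast
  let ?r = "\<lambda>z. if snd z \<in> P then z else r z"
  have "continuous_on ({0..1} \<times> P \<union> {0..1} \<times> Q) ?r"
    using assms(1,2) r(1) rid
    by (intro continuous_on_cases closed_Times) (auto intro!: continuous_intros)
  moreover have "{0..1::real} \<times> P \<union> {0..1} \<times> Q = {0..1} \<times> (P \<union> Q)" by auto
  moreover have "?r \<in> {0..1} \<times> (P \<union> Q) \<rightarrow> {0} \<times> (P \<union> Q) \<union> {0..1} \<times> P"
  proof
    fix z :: "real \<times> 'a" assume "z \<in> {0..1} \<times> (P \<union> Q)"
    then show "?r z \<in> {0} \<times> (P \<union> Q) \<union> {0..1} \<times> P"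
      using funcset_mem[OF r(2), of z] by (cases z) auto
  qed
  ultimately show ?thesis
    unfolding hep_def using rid by (intro conjI exI[of _ ?r]) auto
qed

text \<open>Follow the retraction by \<open>h\<close> on the cylinder over \<open>A\<close> and by
  \<open>g\<close> on the bottom. Tracking \<open>Y\<close> keeps the extended homotopy inside the
  set in which the two partial maps live.\<close>

lemma hep_extend:
  fixes X :: "'a::topological_space set" and g :: "'a \<Rightarrow> 'b::topological_space"
  assumes "hep X A" "closed X" "closed A"
    and h: "continuous_on ({0..1::real} \<times> A) h" "h \<in> {0..1} \<times> A \<rightarrow> Y"
    and g: "continuous_on X g" "g \<in> X \<rightarrow> Y"
    and hg: "\<And>a. a \<in> A \<Longrightarrow> h (0, a) = g a"
  obtains H where "continuous_on ({0..1::real} \<times> X) H" "H \<in> {0..1} \<times> X \<rightarrow> Y"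
    "\<And>x. x \<in> X \<Longrightarrow> H (0, x) = g x" "\<And>t a. t \<in> {0..1} \<Longrightarrow> a \<in> A \<Longrightarrow> H (t, a) = h (t, a)"
proof -
  obtain r where AX: "A \<subseteq> X" and r: "continuous_on ({0..1::real} \<times> X) r"
      "r \<in> {0..1} \<times> X \<rightarrow> {0} \<times> X \<union> {0..1} \<times> A"
      and rid: "\<And>z. z \<in> {0} \<times> X \<union> {0..1} \<times> A \<Longrightarrow> r z = z"
    using assms(1) unfolding hep_def by blast
  let ?G = "\<lambda>z. if snd z \<in> A then h z else g (snd z)"
  have "continuous_on ({0..1} \<times> A \<union> {0} \<times> X) ?G"
    using assms(2,3) h(1) hg g(1)
    by (intro continuous_on_cases closed_Times)
      (auto intro!: continuous_on_compose2[OF g(1)] continuous_intros)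
  then have "continuous_on ({0..1} \<times> X) (\<lambda>z. ?G (r z))"
    using r(2) by (intro continuous_on_compose2[OF _ r(1)]) (auto simp only: Pi_iff Un_commute image_subset_iff)
  moreover have "(\<lambda>z. ?G (r z)) \<in> {0..1} \<times> X \<rightarrow> Y"
  proof
    fix z :: "real \<times> 'a" assume "z \<in> {0..1} \<times> X"
    then have "r z \<in> {0} \<times> X \<union> {0..1} \<times> A" using r(2) by blast
    then show "?G (r z) \<in> Y"
      using h(2) g(2) by auto
  qed
  ultimately show ?thesis
    by (rule that) (use rid hg AX in auto)
qed

lemma contractible_obtain:
  assumes "contractible S" "S \<noteq> {}"
  obtains h a where "a \<in> S" "continuous_on ({0..1::real} \<times> S) h" "h \<in> {0..1} \<times> S \<rightarrow> S"
    "\<And>x. x \<in> S \<Longrightarrow> h (0, x) = x" "\<And>x. x \<in> S \<Longrightarrow> h (1, x) = a"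
proof -
  obtain a where "homotopic_with_canon (\<lambda>x. True) S S id (\<lambda>x. a)"
    using assms(1) unfolding contractible_def by blast
  then obtain h where h: "continuous_on ({0..1::real} \<times> S) h" "h \<in> {0..1} \<times> S \<rightarrow> S"
      "\<And>x. h (0, x) = x" "\<And>x. h (1, x) = a"
    unfolding homotopic_with_def by (force simp: image_subset_iff_funcset)
  moreover have "a \<in> S" using assms(2) funcset_mem[OF h(2)] h(4)
    by (metis SigmaI atLeastAtMost_iff ex_in_conv order_refl zero_le_one)
  ultimately show ?thesis using that by metis
qed

lemma homotopic_with_canonI:
  fixes S :: "'a::topological_space set" and T :: "'b::topological_space set"
  assumes "continuous_on ({0..1::real} \<times> S) h" "h \<in> {0..1} \<times> S \<rightarrow> T"
    "\<And>x. x \<in> S \<Longrightarrow> h (0, x) = f x" "\<And>x. x \<in> S \<Longrightarrow> h (1, x) = g x"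
  shows "homotopic_with_canon (\<lambda>x. True) S T f g"
  using assms by (subst homotopic_with) (auto intro!: exI[of _ h])

text \<open>Three successive homotopies: contract \<open>P\<close> to a point; contract \<open>P \<inter> Q\<close> to a point inside \<open>Q\<close>;
  then contract \<open>Q\<close>, letting all of \<open>P\<close> follow the track of that last point.\<close>

lemma contractible_glue:
  assumes closed: "closed P" "closed Q"
    and contr: "contractible P" "contractible Q" "contractible (P \<inter> Q)" and ne: "P \<inter> Q \<noteq> {}"
    and hep: "hep Q (P \<inter> Q)"
  shows "contractible (P \<union> Q)"
proof -
  let ?X = "P \<union> Q" and ?A = "P \<inter> Q"
  have PQ: "P \<noteq> {}" "Q \<noteq> {}" "closed ?X" "closed ?A" using ne closed by auto
  obtain p p1 where p: "p1 \<in> P" "continuous_on ({0..1::real} \<times> P) p" "p \<in> {0..1} \<times> P \<rightarrow> P"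
    "\<And>x. x \<in> P \<Longrightarrow> p (0, x) = x" "\<And>x. x \<in> P \<Longrightarrow> p (1, x) = p1"
    by (rule contractible_obtain[OF contr(1) PQ(1)]) (rule that)
  obtain q q1 where q: "q1 \<in> Q" "continuous_on ({0..1::real} \<times> Q) q" "q \<in> {0..1} \<times> Q \<rightarrow> Q"
    "\<And>x. x \<in> Q \<Longrightarrow> q (0, x) = x" "\<And>x. x \<in> Q \<Longrightarrow> q (1, x) = q1"
    by (rule contractible_obtain[OF contr(2) PQ(2)]) (rule that)
  obtain a a1 where a: "a1 \<in> ?A" "continuous_on ({0..1::real} \<times> ?A) a" "a \<in> {0..1} \<times> ?A \<rightarrow> ?A"
    "\<And>x. x \<in> ?A \<Longrightarrow> a (0, x) = x" "\<And>x. x \<in> ?A \<Longrightarrow> a (1, x) = a1"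
    by (rule contractible_obtain[OF contr(3) ne]) (rule that)
  obtain G where G: "continuous_on ({0..1::real} \<times> ?X) G" "G \<in> {0..1} \<times> ?X \<rightarrow> ?X"
    "\<And>x. x \<in> ?X \<Longrightarrow> G (0, x) = x" "\<And>t x. t \<in> {0..1} \<Longrightarrow> x \<in> P \<Longrightarrow> G (t, x) = p (t, x)"
    by (rule hep_extend[OF hep_Un[OF closed hep] PQ(3) closed(1) p(2), of ?X "\<lambda>x. x"])
      (use p in auto)
  obtain F where F: "continuous_on ({0..1::real} \<times> Q) F" "F \<in> {0..1} \<times> Q \<rightarrow> Q"
    "\<And>x. x \<in> Q \<Longrightarrow> F (0, x) = x" "\<And>t x. t \<in> {0..1} \<Longrightarrow> x \<in> ?A \<Longrightarrow> F (t, x) = a (t, x)"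
    by (rule hep_extend[OF hep closed(2) PQ(4) a(2), of Q "\<lambda>x. x"])
      (use a in auto)
  have G1: "continuous_on ?X (\<lambda>x. G (1, x))" "\<And>x. x \<in> ?X \<Longrightarrow> G (1, x) \<in> ?X"
    "\<And>x. x \<in> P \<Longrightarrow> G (1, x) = p1"
    using G(2,4) p(5) by (auto intro!: continuous_on_compose2[OF G(1)] continuous_intros)
  have F1: "continuous_on Q (\<lambda>x. F (1, x))" "\<And>x. x \<in> Q \<Longrightarrow> F (1, x) \<in> Q"
    "\<And>x. x \<in> ?A \<Longrightarrow> F (1, x) = a1"
    using F(2,4) a(5) by (auto intro!: continuous_on_compose2[OF F(1)] continuous_intros)
  have FA: "\<And>t x. t \<in> {0..1} \<Longrightarrow> x \<in> ?A \<Longrightarrow> F (t, x) \<in> ?A"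
    using F(4) a(3) by (metis SigmaI funcset_mem)
  have UnI: "{0..1::real} \<times> P \<union> {0..1} \<times> Q = {0..1} \<times> ?X" by auto
  have 1: "homotopic_with_canon (\<lambda>x. True) ?X ?X id (\<lambda>x. G (1, x))"
    by (rule homotopic_with_canonI[OF G(1,2)]) (use G(3) in auto)
  \<comment> \<open>The branches agree on \<open>P \<inter> Q\<close>: there \<open>F\<close> stays
    inside \<open>P \<inter> Q\<close>, and \<open>G (1, _)\<close> is constantly \<open>p1\<close>
    on \<open>P\<close>.\<close>
  let ?h2 = "\<lambda>z. if snd z \<in> P then p1 else G (1, F z)"
  have c2: "continuous_on ({0..1} \<times> ?X) ?h2"
    unfolding UnI[symmetric] using closed F(1,2) FA G1(3)
    by (intro continuous_on_cases closed_Times)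
      (auto intro!: continuous_on_compose2[OF G1(1) F(1)] continuous_intros)
  have 2: "homotopic_with_canon (\<lambda>x. True) ?X ?X (\<lambda>x. G (1, x)) (\<lambda>x. if x \<in> P then p1 else G (1, F (1, x)))"
  proof (rule homotopic_with_canonI[OF c2])
    show "?h2 \<in> {0..1} \<times> ?X \<rightarrow> ?X"
    proof
      fix z :: "real \<times> 'a" assume "z \<in> {0..1} \<times> ?X"
      then have "snd z \<notin> P \<Longrightarrow> F z \<in> Q" using F(2) by auto
      then show "?h2 z \<in> ?X" using p(1) G1(2)[of "F z"] by auto
    qed
  qed (use F(3) G1(3) in auto)
  \<comment> \<open>\<open>F (1, _)\<close> sends \<open>P \<inter> Q\<close> to \<open>a1\<close>,
    so the branches agree on it. At time 0 the first branch is \<open>G (1, a1) = p1\<close>, which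
    is where the second homotopy left \<open>P\<close>.\<close>
  let ?h3 = "\<lambda>z. if snd z \<in> P then G (1, q (fst z, a1)) else G (1, q (fst z, F (1, snd z)))"
  have c3: "continuous_on ({0..1} \<times> ?X) ?h3"
    unfolding UnI[symmetric]
  proof (intro continuous_on_cases)
    show "continuous_on ({0..1} \<times> P) (\<lambda>z. G (1, q (fst z, a1)))"
      using q a(1) by (intro continuous_on_compose2[OF G1(1)] continuous_on_compose2[OF q(2)] continuous_intros) auto
    show "continuous_on ({0..1} \<times> Q) (\<lambda>z. G (1, q (fst z, F (1, snd z))))"
      using q F1 by (intro continuous_on_compose2[OF G1(1)] continuous_on_compose2[OF q(2)]
          continuous_on_compose2[OF F1(1)] continuous_intros) auto
  qed (use closed F1 in \<open>auto intro!: closed_Times\<close>)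
  have 3: "homotopic_with_canon (\<lambda>x. True) ?X ?X (\<lambda>x. if x \<in> P then p1 else G (1, F (1, x))) (\<lambda>x. G (1, q1))"
  proof (rule homotopic_with_canonI[OF c3])
    show "?h3 \<in> {0..1} \<times> ?X \<rightarrow> ?X"
    proof
      fix z :: "real \<times> 'a" assume z: "z \<in> {0..1} \<times> ?X"
      then have "q (fst z, a1) \<in> Q" using q(3) a(1) by auto
      moreover have "q (fst z, F (1, snd z)) \<in> Q" if "snd z \<notin> P"
        using z that F1(2)[of "snd z"] funcset_mem[OF q(3), of "(fst z, F (1, snd z))"] by auto
      ultimately show "?h3 z \<in> ?X" using G1(2) by auto
    qed
  qed (use q F1 G1 a(1) in auto)
  show ?thesis
    unfolding contractible_def using homotopic_with_trans[OF homotopic_with_trans[OF 1 2] 3] by blast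
qed

section \<open>Collapsing a contractible subset of a compact space\<close>

lemma continuous_on_lift_compact:
  fixes f :: "'a::metric_space \<Rightarrow> 'b::metric_space" and h :: "'a \<Rightarrow> 'c::topological_space"
  assumes "compact D" "continuous_on D f" "continuous_on D h"
    and "\<And>x y. x \<in> D \<Longrightarrow> y \<in> D \<Longrightarrow> f x = f y \<Longrightarrow> h x = h y"
  obtains g where "continuous_on (f ` D) g" "\<And>x. x \<in> D \<Longrightarrow> g (f x) = h x"
proof -
  have "quotient_map (top_of_set D) (top_of_set (f ` D)) f"
    using assms(1,2) by (intro continuous_imp_quotient_map)
      (auto simp: compact_space_subtopology intro!: Hausdorff_space_subtopology Hausdorff_space_euclidean)
  then obtain g where "continuous_map (top_of_set (f ` D)) euclidean g" "\<And>x. x \<in> D \<Longrightarrow> g (f x) = h x"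
    using quotient_map_lift_exists[of "top_of_set D" "top_of_set (f ` D)" f euclidean h] assms(3,4)
    by (metis continuous_map_iff_continuous topspace_euclidean_subtopology)
  then show ?thesis using that by (metis continuous_map_iff_continuous)
qed

lemma homotopy_equivalent_collapse:
  fixes f :: "'a::metric_space \<Rightarrow> 'b::metric_space"
  assumes D: "compact D" and K: "closed K" "hep D K" "contractible K" "K \<noteq> {}"
    and f: "continuous_on D f"
    and eq: "\<And>x y. x \<in> D \<Longrightarrow> y \<in> D \<Longrightarrow> f x = f y \<longleftrightarrow> x = y \<or> x \<in> K \<and> y \<in> K"
  shows "top_of_set D homotopy_equivalent_space top_of_set (f ` D)"
proof -
  have KD: "K \<subseteq> D" using K(2) unfolding hep_def by blast
  obtain k k1 where k: "k1 \<in> K" "continuous_on ({0..1::real} \<times> K) k" "k \<in> {0..1} \<times> K \<rightarrow> K"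
    "\<And>x. x \<in> K \<Longrightarrow> k (0, x) = x" "\<And>x. x \<in> K \<Longrightarrow> k (1, x) = k1"
    by (rule contractible_obtain[OF K(3,4)]) (rule that)
  obtain H where H: "continuous_on ({0..1::real} \<times> D) H" "H \<in> {0..1} \<times> D \<rightarrow> D"
    "\<And>x. x \<in> D \<Longrightarrow> H (0, x) = x" "\<And>t x. t \<in> {0..1} \<Longrightarrow> x \<in> K \<Longrightarrow> H (t, x) = k (t, x)"
    by (rule hep_extend[OF K(2) compact_imp_closed[OF D] K(1) k(2), of D "\<lambda>x. x"])
      (use k KD in auto)
  have HK: "H (t, x) \<in> K" if "t \<in> {0..1}" "x \<in> K" for t x
    using that H(4) k(3) by (metis SigmaI funcset_mem)
  have HD: "H (t, x) \<in> D" if "t \<in> {0..1}" "x \<in> D" for t x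
    using that H(2) by auto
  have H1: "continuous_on D (\<lambda>x. H (1, x))"
    by (auto intro!: continuous_on_compose2[OF H(1)] continuous_intros)
  have "H (1, x) = H (1, y)" if "x \<in> D" "y \<in> D" "f x = f y" for x y
    using eq[OF that(1,2)] that H(4) k(5) by auto
  then obtain g where g: "continuous_on (f ` D) g" "\<And>x. x \<in> D \<Longrightarrow> g (f x) = H (1, x)"
    using continuous_on_lift_compact[OF D f H1] by blast
  \<comment> \<open>Compactness of the whole cylinder makes \<open>?F\<close> a quotient map onto
    its image, so the homotopy descends jointly continuously and not merely stage by stage.\<close>
  let ?F = "\<lambda>z::real \<times> 'a. (fst z, f (snd z))"
  have cI: "compact ({0..1::real} \<times> D)" using D by (intro compact_Times) auto
  have F: "continuous_on ({0..1} \<times> D) ?F"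
    by (auto intro!: continuous_intros continuous_on_compose2[OF f])
  have fH: "continuous_on ({0..1} \<times> D) (\<lambda>z. f (H z))"
    using H(2) by (intro continuous_on_compose2[OF f H(1)]) auto
  have "f (H x) = f (H y)" if xyD: "x \<in> {0..1} \<times> D" "y \<in> {0..1} \<times> D" "?F x = ?F y" for x y
  proof -
    obtain t x' y' where xy: "x = (t, x')" "y = (t, y')" using xyD(3) by (cases x; cases y) auto
    then have "x' = y' \<or> x' \<in> K \<and> y' \<in> K" "t \<in> {0..1}" "x' \<in> D" "y' \<in> D"
      using xyD eq by auto
    then show ?thesis using xy eq[OF HD HD] HK by (metis)
  qed
  then obtain J where J: "continuous_on (?F ` ({0..1} \<times> D)) J"
      "\<And>z. z \<in> {0..1} \<times> D \<Longrightarrow> J (?F z) = f (H z)"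
    using continuous_on_lift_compact[OF cI F fH] by blast
  have im: "?F ` ({0..1} \<times> D) = {0..1} \<times> f ` D" by force
  have J': "J (t, f x) = f (H (t, x))" if "t \<in> {0..1}" "x \<in> D" for t x
    using J(2)[of "(t, x)"] that by auto
  have "homotopic_with_canon (\<lambda>x. True) D D id (g \<circ> f)"
    by (rule homotopic_with_canonI[OF H(1,2)]) (use H(3) g in auto)
  moreover have "homotopic_with_canon (\<lambda>x. True) (f ` D) (f ` D) id (f \<circ> g)"
    by (rule homotopic_with_canonI[OF J(1)[unfolded im]]) (use J' H(3) g(2) HD in auto)
  moreover have "g ` (f ` D) \<subseteq> D" using g(2) HD by auto
  ultimately show ?thesis
    unfolding homotopy_equivalent_space_def using f g(1)
    by (intro exI[of _ f] exI[of _ g]) (auto simp: homotopic_with_sym)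
qed

section \<open>The configuration space and its top cells\<close>

text \<open>Entries outside the rows in \<open>C\<close> and the first \<open>N\<close> columns are
  zero. All colour sets and vertex numbers thus share one type, and \<open>conf C N\<close> is
  literally the part of \<open>conf C (Suc N)\<close> with zero last column.\<close>

definition conf :: "nat set \<Rightarrow> nat \<Rightarrow> (nat \<Rightarrow> nat \<Rightarrow> real) set" where
  "conf C N = {x. (\<forall>c j. 0 \<le> x c j) \<and> (\<forall>c j. c \<notin> C \<or> N \<le> j \<longrightarrow> x c j = 0) \<and>
     (\<forall>c\<in>C. (\<Sum>j<N. x c j) = 1) \<and> (\<forall>c d j. c \<noteq> d \<longrightarrow> x c j = 0 \<or> x d j = 0)}"

lemma continuous_on_entry [continuous_intros]:
  fixes S :: "('a \<Rightarrow> 'b \<Rightarrow> 'c::topological_space) set"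
  shows "continuous_on S (\<lambda>x. x c j)"
  by (rule continuous_on_product_then_coordinatewise,
      rule continuous_on_product_then_coordinatewise, rule continuous_on_id)

lemma continuous_on_entry_snd [continuous_intros]:
  fixes S :: "('d::topological_space \<times> ('a \<Rightarrow> 'b \<Rightarrow> 'c::topological_space)) set"
  shows "continuous_on S (\<lambda>z. snd z c j)"
  by (rule continuous_on_product_then_coordinatewise,
      rule continuous_on_product_then_coordinatewise, intro continuous_on_snd continuous_on_id)

lemma conf_le_1:
  assumes "x \<in> conf C N" shows "x c j \<le> 1"
proof (cases "c \<in> C \<and> j < N")
  case True
  then have "x c j \<le> (\<Sum>j<N. x c j)"
    using assms by (intro member_le_sum) (auto simp: conf_def)
  then show ?thesis using assms True by (auto simp: conf_def)
qed (use assms in \<open>auto simp: conf_def\<close>)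

lemma closed_conf: "closed (conf C N)"
proof -
  have "conf C N = (\<Inter>c. \<Inter>j. {x. 0 \<le> x c j}) \<inter> (\<Inter>c. \<Inter>j. {x. c \<notin> C \<or> N \<le> j \<longrightarrow> x c j = 0}) \<inter>
     (\<Inter>c\<in>C. {x. (\<Sum>j<N. x c j) = 1}) \<inter> (\<Inter>c. \<Inter>d. \<Inter>j. {x. c \<noteq> d \<longrightarrow> x c j * x d j = 0})"
    by (simp add: Set.set_eq_iff conf_def)
  moreover have "closed {x::nat \<Rightarrow> nat \<Rightarrow> real. 0 \<le> x c j}" for c j
    by (intro closed_Collect_le continuous_intros)
  moreover have "closed {x::nat \<Rightarrow> nat \<Rightarrow> real. c \<notin> C \<or> N \<le> j \<longrightarrow> x c j = 0}" for c j
    by (intro closed_Collect_imp closed_Collect_eq open_Collect_const continuous_intros)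
  moreover have "closed {x::nat \<Rightarrow> nat \<Rightarrow> real. c \<noteq> d \<longrightarrow> x c j * x d j = 0}" for c d j
    by (intro closed_Collect_imp closed_Collect_eq open_Collect_const continuous_intros)
  moreover have "closed {x::nat \<Rightarrow> nat \<Rightarrow> real. (\<Sum>j<N. x c j) = 1}" for c
    by (intro closed_Collect_eq continuous_intros)
  ultimately show ?thesis by (auto intro!: closed_Int closed_INT)
qed

lemma compact_conf: "compact (conf C N)"
proof -
  have PiE_UNIV: "compact (PiE UNIV S)" if "\<And>i. compact (S i)" for S :: "nat \<Rightarrow> 'b::metric_space set"
    using that compactin_PiE[of "\<lambda>_. euclidean" UNIV S]
    by (simp add: euclidean_product_topology)
  have "compact (PiE UNIV (\<lambda>_::nat. PiE UNIV (\<lambda>_::nat. {0..1::real})))"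
    by (intro PiE_UNIV compact_Icc)
  moreover have "conf C N \<subseteq> PiE UNIV (\<lambda>_. PiE UNIV (\<lambda>_. {0..1}))"
    using conf_le_1 by (auto simp: conf_def)
  ultimately show ?thesis
    using compact_Int_closed[OF _ closed_conf] by (metis inf.absorb_iff2)
qed

section \<open>Top cells and their depth functions\<close>

lemma continuous_on_Min_image:
  fixes f :: "'i \<Rightarrow> 'a::topological_space \<Rightarrow> real"
  assumes "finite I" "I \<noteq> {}" "\<And>i. i \<in> I \<Longrightarrow> continuous_on S (f i)"
  shows "continuous_on S (\<lambda>x. Min ((\<lambda>i. f i x) ` I))"
  using assms by (induction I rule: finite_ne_induct) (auto intro: continuous_on_min)

text \<open>Inside \<open>conf C N\<close> this is the interior of a top cell, since a positive
  entry excludes all other colours from its column. Leaving out the intersection with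
  \<open>conf C N\<close> makes the set open in the space of all matrices, so removing cells leaves
  a closed set.\<close>

definition open_cell :: "(nat \<Rightarrow> nat) \<Rightarrow> nat \<Rightarrow> (nat \<Rightarrow> nat \<Rightarrow> real) set" where
  "open_cell \<alpha> N = {x. \<forall>j<N. 0 < x (\<alpha> j) j}"

definition block_size :: "(nat \<Rightarrow> nat) \<Rightarrow> nat \<Rightarrow> nat \<Rightarrow> real" where
  "block_size \<alpha> N c = real (card {i. i < N \<and> \<alpha> i = c})"

definition barycenter :: "(nat \<Rightarrow> nat) \<Rightarrow> nat \<Rightarrow> nat \<Rightarrow> nat \<Rightarrow> real" where
  "barycenter \<alpha> N c j = (if j < N \<and> \<alpha> j = c then 1 / block_size \<alpha> N c else 0)"

text \<open>Zero on the boundary of the cell of \<open>\<alpha>\<close>, one at its barycenter, and affine on every ray that leaves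
  the barycenter.\<close>

definition depth :: "(nat \<Rightarrow> nat) \<Rightarrow> nat \<Rightarrow> (nat \<Rightarrow> nat \<Rightarrow> real) \<Rightarrow> real" where
  "depth \<alpha> N x = Min ((\<lambda>j. block_size \<alpha> N (\<alpha> j) * x (\<alpha> j) j) ` {..<N})"

lemma block_size_ge_1: "j < N \<Longrightarrow> 1 \<le> block_size \<alpha> N (\<alpha> j)"
  unfolding block_size_def by (simp add: Suc_le_eq card_gt_0_iff) blast

lemma sum_over_block: "(\<Sum>j<(N::nat). if \<alpha> j = c then f j else (0::real)) = sum f {i. i < N \<and> \<alpha> i = c}"
  using sum.inter_filter[of "{..<N}" f "\<lambda>j. \<alpha> j = c"] by simp

lemma sum_barycenter: "c \<in> \<alpha> ` {..<N} \<Longrightarrow> (\<Sum>j<N. barycenter \<alpha> N c j) = 1"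
proof -
  assume "c \<in> \<alpha> ` {..<N}"
  then obtain i where i: "i < N" "\<alpha> i = c" by auto
  have "(\<Sum>j<N. barycenter \<alpha> N c j) = (\<Sum>j<N. if \<alpha> j = c then 1 / block_size \<alpha> N c else 0)"
    by (intro sum.cong) (auto simp: barycenter_def)
  also have "\<dots> = block_size \<alpha> N c * (1 / block_size \<alpha> N c)"
    unfolding sum_over_block by (simp add: block_size_def)
  also have "\<dots> = 1" using block_size_ge_1[OF i(1), of \<alpha>] i(2) by simp
  finally show ?thesis .
qed

lemma continuous_on_depth [continuous_intros]:
  assumes "0 < N" "continuous_on S f"
  shows "continuous_on S (\<lambda>z. depth \<alpha> N (f z))"
proof -
  have "continuous_on UNIV (depth \<alpha> N)"
    unfolding depth_def using assms(1)
    by (intro continuous_on_Min_image continuous_intros) auto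
  then show ?thesis
    by (rule continuous_on_compose2[OF _ assms(2)]) auto
qed

lemma depth_le: "j < N \<Longrightarrow> depth \<alpha> N x \<le> block_size \<alpha> N (\<alpha> j) * x (\<alpha> j) j"
  unfolding depth_def by (intro Min_le) auto

lemma depth_attained:
  assumes "0 < N"
  obtains j where "j < N" "depth \<alpha> N x = block_size \<alpha> N (\<alpha> j) * x (\<alpha> j) j"
proof -
  have "depth \<alpha> N x \<in> (\<lambda>j. block_size \<alpha> N (\<alpha> j) * x (\<alpha> j) j) ` {..<N}"
    unfolding depth_def using assms by (intro Min_in) auto
  then show ?thesis using that by auto
qed

lemma depth_nonneg:
  assumes "0 < N" "x \<in> conf C N" shows "0 \<le> depth \<alpha> N x"
  using depth_attained[OF assms(1), of \<alpha> x] assms(2) block_size_ge_1[of _ N \<alpha>]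
  by (metis (no_types, lifting) conf_def mem_Collect_eq mult_nonneg_nonneg order_trans zero_le_one)

lemma depth_pos_iff:
  assumes "0 < N"
  shows "0 < depth \<alpha> N x \<longleftrightarrow> x \<in> open_cell \<alpha> N"
proof
  assume "0 < depth \<alpha> N x"
  then show "x \<in> open_cell \<alpha> N"
    unfolding open_cell_def using depth_le[of _ N \<alpha> x] block_size_ge_1[of _ N \<alpha>]
    by (smt (verit, best) mem_Collect_eq zero_less_mult_iff)
next
  assume x: "x \<in> open_cell \<alpha> N"
  obtain j where "j < N" "depth \<alpha> N x = block_size \<alpha> N (\<alpha> j) * x (\<alpha> j) j"
    using depth_attained[OF assms] by blast
  then show "0 < depth \<alpha> N x"
    using x block_size_ge_1[of j N \<alpha>] unfolding open_cell_def by simp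
qed

lemma depth_eq_0:
  assumes "0 < N" "x \<in> conf C N" "x \<notin> open_cell \<alpha> N" shows "depth \<alpha> N x = 0"
  using depth_nonneg[OF assms(1,2), of \<alpha>] depth_pos_iff[OF assms(1)] assms(3) by force

lemma confD:
  assumes "x \<in> conf C N"
  shows "0 \<le> x c j" and "c \<notin> C \<Longrightarrow> x c j = 0" and "N \<le> j \<Longrightarrow> x c j = 0"
    and "c \<in> C \<Longrightarrow> (\<Sum>j<N. x c j) = 1" and "c \<noteq> d \<Longrightarrow> x c j = 0 \<or> x d j = 0"
  using assms unfolding conf_def by simp_all

lemma conf_open_cell_off:
  assumes "x \<in> conf C N" "x \<in> open_cell \<alpha> N" "c \<noteq> \<alpha> j \<or> N \<le> j"
  shows "x c j = 0"
proof (cases "N \<le> j")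
  case True then show ?thesis using confD(3)[OF assms(1)] by simp
next
  case False
  then have "0 < x (\<alpha> j) j" "c \<noteq> \<alpha> j" using assms(2,3) by (auto simp: open_cell_def)
  then show ?thesis using confD(5)[OF assms(1), of c "\<alpha> j" j] by auto
qed

lemma open_cell_unique:
  assumes "x \<in> conf C N" "x \<in> open_cell \<alpha> N" "x \<in> open_cell \<beta> N" "j < N"
  shows "\<alpha> j = \<beta> j"
  using conf_open_cell_off[OF assms(1,2), of "\<beta> j" j] assms(3,4) unfolding open_cell_def
  by force

text \<open>\<open>y\<close> lies on the ray from the barycenter through \<open>x\<close>; its depth is \<open>(depth x - m) / (1 - m)\<close>.\<close>

lemma stretch:
  fixes \<alpha> N m x
  defines "y \<equiv> \<lambda>c j. x c j + (1 / (1 - m) - 1) * (x c j - barycenter \<alpha> N c j)"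
  assumes N: "0 < N" and x: "x \<in> conf C N" "x \<in> open_cell \<alpha> N" and \<alpha>: "\<alpha> ` {..<N} = C"
    and m: "0 \<le> m" "m < 1" "m \<le> depth \<alpha> N x"
  shows "y \<in> conf C N" and "\<And>c j. 0 < y c j \<Longrightarrow> 0 < x c j"
    and "m = depth \<alpha> N x \<Longrightarrow> y \<notin> open_cell \<alpha> N"
proof -
  \<comment> \<open>The numerator is nonnegative because \<open>m\<close> is at most the depth, and
    for \<open>m\<close> equal to the depth it vanishes at a vertex that attains the
    minimum.\<close>
  have y: "y (\<alpha> j) j = (block_size \<alpha> N (\<alpha> j) * x (\<alpha> j) j - m) / (block_size \<alpha> N (\<alpha> j) * (1 - m))"
    if "j < N" for j
    using block_size_ge_1[OF that, of \<alpha>] m that by (simp add: y_def barycenter_def field_simps)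
  have y0: "y c j = 0" if "c \<noteq> \<alpha> j \<or> N \<le> j" for c j
    using conf_open_cell_off[OF x that] that by (auto simp: y_def barycenter_def)
  have y_nonneg: "0 \<le> y c j" for c j
  proof (cases "c \<noteq> \<alpha> j \<or> N \<le> j")
    case False
    then show ?thesis
      using y[of j] depth_le[of j N \<alpha> x] m block_size_ge_1[of j N \<alpha>] by auto
  qed (use y0 in simp)
  have sum: "(\<Sum>j<N. y c j) = 1" if "c \<in> C" for c
  proof -
    have "(\<Sum>j<N. y c j) = (\<Sum>j<N. x c j) + (1 / (1 - m) - 1) * ((\<Sum>j<N. x c j) - (\<Sum>j<N. barycenter \<alpha> N c j))"
      by (simp add: y_def sum.distrib sum_distrib_left sum_subtractf right_diff_distrib)
    then show ?thesis using sum_barycenter[of c \<alpha> N] that \<alpha> x by (auto simp: conf_def)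
  qed
  have out: "y c j = 0" if "c \<notin> C" for c j
    using that \<alpha> y0[of c j] by (metis imageI lessThan_iff not_le)
  show "y \<in> conf C N"
    unfolding conf_def using y_nonneg y0 sum out by (auto; metis)
  show "0 < x c j" if "0 < y c j" for c j
  proof -
    have "c = \<alpha> j \<and> j < N" using that y0[of c j] by fastforce
    then show ?thesis using x(2) by (auto simp: open_cell_def)
  qed
  show "y \<notin> open_cell \<alpha> N" if "m = depth \<alpha> N x"
  proof -
    obtain j where "j < N" "depth \<alpha> N x = block_size \<alpha> N (\<alpha> j) * x (\<alpha> j) j"
      using depth_attained[OF N] by blast
    then have "y (\<alpha> j) j = 0" using y[of j] that by simp
    then show ?thesis using \<open>j < N\<close> unfolding open_cell_def by force
  qed
qed

text \<open>Over each removed cell, project the cylinder from a point at height 2 above the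
  barycenter onto the bottom and the side. For depth \<open>s\<close> and time \<open>t\<close>, the
  projection line meets the bottom if \<open>t \<le> 2 * s\<close> and the side otherwise; either
  way the deviation from the barycenter is stretched by \<open>1 / (1 - min s (t / 2))\<close>. The
  exact height on the side would be \<open>(t - 2 * s) / (1 - s)\<close>; it is replaced by
  \<open>t - 2 * s\<close>, which has the same zeros.\<close>

lemma hep_remove_cells:
  fixes R :: "(nat \<Rightarrow> nat) set"
  assumes N: "0 < N" and R: "finite R" "\<And>\<alpha>. \<alpha> \<in> R \<Longrightarrow> \<alpha> ` {..<N} = C"
    and R_inj: "\<And>\<alpha> \<beta>. \<alpha> \<in> R \<Longrightarrow> \<beta> \<in> R \<Longrightarrow> \<forall>j<N. \<alpha> j = \<beta> j \<Longrightarrow> \<alpha> = \<beta>"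
  shows "hep (conf C N) (conf C N - (\<Union>\<alpha>\<in>R. open_cell \<alpha> N))" (is "hep ?D ?K")
proof -
  define s where "s = (\<lambda>\<alpha>. depth \<alpha> N)"
  \<comment> \<open>The open cells of \<open>R\<close> are disjoint in \<open>?D\<close>, so at most
    one summand is nonzero and summing replaces a case distinction that would have to be pasted. The
    bound \<open>t / 2 \<le> 1 / 2\<close> keeps the denominators away from zero.\<close>
  define r where "r = (\<lambda>z::real \<times> (nat \<Rightarrow> nat \<Rightarrow> real).
    (max 0 (fst z - 2 * (\<Sum>\<alpha>\<in>R. s \<alpha> (snd z))),
     \<lambda>c j. snd z c j + (\<Sum>\<alpha>\<in>R. (1 / (1 - min (s \<alpha> (snd z)) (fst z / 2)) - 1) *
       (snd z c j - barycenter \<alpha> N c j))))"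
  have s0: "s \<alpha> x = 0" if "x \<in> ?D" "x \<notin> open_cell \<alpha> N" for \<alpha> x
    using depth_eq_0[OF N that] by (simp add: s_def)
  have r_K: "r (t, x) = (t, x)" if "x \<in> ?K" "t \<in> {0..1}" for t x
    using that s0 by (auto simp: r_def)
  have r_cell: "r (t, x) = (max 0 (t - 2 * s \<alpha> x),
      \<lambda>c j. x c j + (1 / (1 - min (s \<alpha> x) (t / 2)) - 1) * (x c j - barycenter \<alpha> N c j))"
    if "x \<in> ?D" "\<alpha> \<in> R" "x \<in> open_cell \<alpha> N" "t \<in> {0..1}" for t x \<alpha>
  proof -
    have "x \<notin> open_cell \<beta> N" if "\<beta> \<in> R" "\<beta> \<noteq> \<alpha>" for \<beta>
      using open_cell_unique[of x C N \<alpha> \<beta>] R_inj[of \<alpha> \<beta>] that \<open>x \<in> ?D\<close> \<open>\<alpha> \<in> R\<close> \<open>x \<in> open_cell \<alpha> N\<close> by blast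
    then have z: "s \<beta> x = 0" if "\<beta> \<in> R - {\<alpha>}" for \<beta>
      using s0[OF \<open>x \<in> ?D\<close>] that by blast
    show ?thesis
      using z that by (simp add: r_def sum.remove[OF R(1) \<open>\<alpha> \<in> R\<close>])
  qed
  have r_0: "r (0, x) = (0, x)" if "x \<in> ?D" for x
    using that by (auto simp: r_def s_def min_absorb2 depth_nonneg[OF N] intro!: max_absorb1 sum_nonneg)
  have "continuous_on ({0..1} \<times> ?D) r"
    unfolding r_def s_def using N
    by (intro continuous_intros) (auto simp: min_def)
  moreover have "r \<in> {0..1} \<times> ?D \<rightarrow> {0} \<times> ?D \<union> {0..1} \<times> ?K"
  proof
    fix z assume "z \<in> {0..1::real} \<times> ?D"
    then obtain t x where z: "z = (t, x)" "t \<in> {0..1}" "x \<in> ?D" by auto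
    show "r z \<in> {0} \<times> ?D \<union> {0..1} \<times> ?K"
    proof (cases "x \<in> ?K")
      case True then show ?thesis using r_K z by auto
    next
      case False
      then obtain \<alpha> where \<alpha>: "\<alpha> \<in> R" "x \<in> open_cell \<alpha> N" using z by auto
      let ?m = "min (s \<alpha> x) (t / 2)"
      define y where "y = (\<lambda>c j. x c j + (1 / (1 - ?m) - 1) * (x c j - barycenter \<alpha> N c j))"
      have m: "0 \<le> ?m" "?m < 1" "?m \<le> depth \<alpha> N x"
        using z depth_nonneg[OF N z(3)] by (auto simp: s_def)
      note st = stretch[OF N z(3) \<alpha>(2) R(2)[OF \<alpha>(1)] m, folded y_def]
      have pos: "0 < x c j" if "0 < y c j" for c j
        using st(2)[of c j] that by (simp add: y_def)
      have rz: "r z = (max 0 (t - 2 * s \<alpha> x), y)"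
        using r_cell[OF z(3) \<alpha> z(2)] z(1) by (simp add: y_def)
      have "y \<in> ?K" if "t > 2 * s \<alpha> x"
      proof -
        have "y \<notin> open_cell \<alpha> N" using st(3) that by (simp add: s_def)
        moreover have "y \<notin> open_cell \<beta> N" if "\<beta> \<in> R" "\<beta> \<noteq> \<alpha>" for \<beta>
        proof
          assume "y \<in> open_cell \<beta> N"
          then have "x \<in> open_cell \<beta> N" using pos by (auto simp: open_cell_def)
          then show False using open_cell_unique[OF z(3) \<alpha>(2)] R_inj[OF \<alpha>(1) that(1)] that by blast
        qed
        ultimately show ?thesis using st(1) by blast
      qed
      then show ?thesis using rz st(1) z(2) depth_nonneg[OF N z(3), of \<alpha>] by (auto simp: s_def max_def)
    qed
  qed
  ultimately show ?thesis
    unfolding hep_def using r_0 r_K by (intro conjI exI[of _ r]) auto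
qed

section \<open>The contractible core\<close>

text \<open>A word lists the colours of the vertices of a top cell in reverse order: its head is the colour of
  the last vertex, and the colour of vertex \<open>j\<close> in the cell of \<open>w\<close> is \<open>rev w ! j\<close>. The clause with
  \<open>distinct w\<close> treats the case in which there are as many colours as vertices: \<open>conf C N\<close> is then
  empty and only the end of one of the cylinders is kept.\<close>

fun removed :: "nat list \<Rightarrow> bool" where
  "removed [] = False"
| "removed (c # w) = (if c \<in> set w then c \<noteq> Min (set (c # w)) \<and> removed w
     else removed w \<or> c \<noteq> Min (set (c # w)) \<and> distinct w)"

definition removed_words :: "nat set \<Rightarrow> nat \<Rightarrow> nat list set" where
  "removed_words C N = {w. length w = N \<and> set w = C \<and> removed w}"

abbreviation word_cell :: "nat list \<Rightarrow> (nat \<Rightarrow> nat \<Rightarrow> real) set" where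
  "word_cell w \<equiv> open_cell ((!) (rev w)) (length w)"

definition core :: "nat set \<Rightarrow> nat \<Rightarrow> (nat \<Rightarrow> nat \<Rightarrow> real) set" where
  "core C N = conf C N - (\<Union>w\<in>removed_words C N. word_cell w)"

lemma in_word_cell_Cons:
  "x \<in> word_cell (c # w) \<longleftrightarrow> 0 < x c (length w) \<and> x \<in> word_cell w"
  unfolding open_cell_def by (auto simp: nth_append less_Suc_eq)

lemma in_word_cell_support:
  assumes "x \<in> word_cell w" "c \<in> set w"
  obtains j where "j < length w" "0 < x c j"
proof -
  obtain j where "j < length w" "rev w ! j = c"
    using assms(2) by (metis in_set_conv_nth length_rev set_rev)
  then show ?thesis using that assms(1) unfolding open_cell_def by auto
qed

text \<open>Used in contrapositive form: a deformation that creates no new positive entries cannot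
  enter an open cell from outside.\<close>

lemma word_cell_mono:
  assumes "y \<in> word_cell w" "\<And>d j. j < length w \<Longrightarrow> 0 < y d j \<Longrightarrow> 0 < x d j"
  shows "x \<in> word_cell w"
  using assms unfolding open_cell_def by auto

lemma open_open_cell: "open (open_cell \<alpha> N)"
proof -
  have "open_cell \<alpha> N = (\<Inter>j\<in>{..<N}. {x. 0 < x (\<alpha> j) j})" by (auto simp: open_cell_def)
  moreover have "open {x::nat \<Rightarrow> nat \<Rightarrow> real. 0 < x c j}" for c j
    by (intro open_Collect_less continuous_intros)
  ultimately show ?thesis by auto
qed

lemma closed_core: "closed (core C N)"
  unfolding core_def by (intro closed_Diff closed_conf open_UN ballI open_open_cell)

text \<open>Without colours there is just the zero matrix, whatever \<open>N\<close> is. The clause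
  \<open>removed []\<close> keeps this point also for \<open>N = 0\<close>, where the induction
  starts.\<close>

lemma core_empty: "core {} N = {\<lambda>_ _. 0}"
proof -
  have "removed_words {} N = {}" by (auto simp: removed_words_def)
  then show ?thesis by (auto simp: core_def conf_def fun_eq_iff)
qed

lemma contractible_retract:
  fixes S T :: "'a::topological_space set"
  assumes H: "continuous_on ({0..1::real} \<times> S) H" "H \<in> {0..1} \<times> S \<rightarrow> S"
    and H0: "\<And>x. x \<in> S \<Longrightarrow> H (0, x) = x" and H1: "\<And>x. x \<in> S \<Longrightarrow> H (1, x) \<in> T"
    and T: "T \<subseteq> S" "contractible T" "T \<noteq> {}"
  shows "contractible S"
proof -
  obtain h a where h: "a \<in> T" "continuous_on ({0..1::real} \<times> T) h" "h \<in> {0..1} \<times> T \<rightarrow> T"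
    "\<And>x. x \<in> T \<Longrightarrow> h (0, x) = x" "\<And>x. x \<in> T \<Longrightarrow> h (1, x) = a"
    by (rule contractible_obtain[OF T(2,3)]) (rule that)
  have 1: "homotopic_with_canon (\<lambda>x. True) S S id (\<lambda>x. H (1, x))"
    by (rule homotopic_with_canonI[OF H]) (use H0 in auto)
  have cH1: "continuous_on ({0..1::real} \<times> S) (\<lambda>z. H (1, snd z))"
    by (rule continuous_on_compose2[OF H(1)]) (auto intro!: continuous_intros)
  have "continuous_on ({0..1} \<times> S) (\<lambda>z. h (fst z, H (1, snd z)))"
    by (rule continuous_on_compose2[OF h(2)])
      (use H1 in \<open>auto intro!: continuous_intros cH1\<close>)
  then have 2: "homotopic_with_canon (\<lambda>x. True) S S (\<lambda>x. H (1, x)) (\<lambda>x. a)"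
  proof (rule homotopic_with_canonI)
    show "(\<lambda>z. h (fst z, H (1, snd z))) \<in> {0..1} \<times> S \<rightarrow> S"
      using h(3) H1 T(1) by (auto simp: Pi_iff)
  qed (use h H1 in auto)
  show ?thesis
    unfolding contractible_def using homotopic_with_trans[OF 1 2] by blast
qed

lemma contractible_homeomorphic_image:
  fixes S :: "'a::topological_space set" and f :: "'a \<Rightarrow> 'b::topological_space"
  assumes "contractible S" "continuous_on S f" "continuous_on (f ` S) g" "\<And>x. x \<in> S \<Longrightarrow> g (f x) = x"
  shows "contractible (f ` S)"
proof -
  have "top_of_set S homeomorphic_space top_of_set (f ` S)"
    unfolding homeomorphic_space_def homeomorphic_maps_def
    by (intro exI[of _ f] exI[of _ g]) (use assms in auto)
  then show ?thesis
    using assms(1) homotopy_equivalent_space_contractibility homeomorphic_imp_homotopy_equivalent_space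
      contractible_space_top_of_set by metis
qed

lemma continuous_on_entries:
  fixes f :: "'a::topological_space \<Rightarrow> nat \<Rightarrow> nat \<Rightarrow> real"
  assumes "\<And>d j. continuous_on S (\<lambda>z. f z d j)"
  shows "continuous_on S f"
  using assms by (intro continuous_on_coordinatewise_then_product)

text \<open>For \<open>c \<noteq> Min C\<close> the last condition cuts the base of the mapping cylinder down to \<open>core C N\<close>.\<close>

definition cyl :: "nat set \<Rightarrow> nat \<Rightarrow> nat \<Rightarrow> (nat \<Rightarrow> nat \<Rightarrow> real) set" where
  "cyl C N c = {x \<in> core C (Suc N). (\<forall>d. d \<noteq> c \<longrightarrow> x d N = 0) \<and>
     (c = Min C \<or> (\<forall>w\<in>removed_words C N. x \<notin> word_cell w))}"

section \<open>The core as a union of cylinders\<close>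

lemma closed_cyl: "closed (cyl C N c)"
proof -
  have "cyl C N c = core C (Suc N) \<inter> (\<Inter>d\<in>-{c}. {x. x d N = 0}) \<inter>
      (if c = Min C then UNIV else \<Inter>w\<in>removed_words C N. - word_cell w)"
    by (auto simp: cyl_def)
  moreover have "closed {x::nat \<Rightarrow> nat \<Rightarrow> real. x d N = 0}" for d
    by (intro closed_Collect_eq continuous_intros)
  moreover have "closed (if c = Min C then UNIV else \<Inter>w\<in>removed_words C N. - word_cell w)"
    by (auto intro!: closed_INT open_open_cell)
  ultimately show ?thesis
    by (metis (no_types, lifting) closed_INT closed_Int closed_core)
qed

lemma conf_sub_Suc: "x \<in> conf C N \<longleftrightarrow> x \<in> conf C (Suc N) \<and> (\<forall>c. x c N = 0)"
  unfolding conf_def by (auto simp: Suc_le_eq le_less_Suc_eq) (metis le_neq_implies_less)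

text \<open>Every open top cell on \<open>N + 1\<close> vertices demands a positive entry in the
  last column, which is zero here.\<close>

lemma core_sub_core_Suc:
  assumes "x \<in> core C N" shows "x \<in> core C (Suc N)" and "x c N = 0"
proof -
  have x: "x \<in> conf C (Suc N)" "\<And>c. x c N = 0"
    using assms conf_sub_Suc[of x C N] by (auto simp: core_def)
  show "x c N = 0" by (rule x)
  have "x \<notin> word_cell w" if w: "w \<in> removed_words C (Suc N)" for w
  proof
    assume *: "x \<in> word_cell w"
    obtain b v where bv: "w = b # v" "length v = N" using w by (cases w) (auto simp: removed_words_def)
    then show False using * x(2)[of b] by (simp only: in_word_cell_Cons) simp
  qed
  then show "x \<in> core C (Suc N)" using x(1) by (auto simp: core_def)
qed

text \<open>Two different colours force the last column to vanish, so the point lies in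
  \<open>conf C N\<close>. The cut-down base of the cylinder for \<open>d\<close> then excludes the
  removed cells, which is why the intersection is the core and not all of
  \<open>conf C N\<close>.\<close>

lemma cyl_Int:
  assumes "c \<noteq> d" "d \<noteq> Min C"
  shows "cyl C N c \<inter> cyl C N d = core C N"
proof (intro equalityI subsetI)
  fix x assume "x \<in> cyl C N c \<inter> cyl C N d"
  then show "x \<in> core C N"
    using assms conf_sub_Suc[of x C N] by (auto simp: cyl_def core_def)
next
  fix x assume "x \<in> core C N"
  then show "x \<in> cyl C N c \<inter> cyl C N d"
    using core_sub_core_Suc[of x C N] by (auto simp: cyl_def) (auto simp: core_def)
qed

text \<open>The last column has at most one nonzero entry, and its row names the cylinder; points
  with zero last column go to the full cylinder. Over a removed cell \<open>w\<close> of
  \<open>conf C N\<close>, a positive last entry in a row \<open>c \<noteq> Min C\<close> would put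
  the point into the removed cell \<open>c # w\<close>.\<close>

lemma core_Suc_eq:
  assumes "finite C" "C \<noteq> {}"
  shows "core C (Suc N) = (\<Union>c\<in>C. cyl C N c)"
proof (intro equalityI subsetI)
  fix x assume x: "x \<in> core C (Suc N)"
  then have xc: "x \<in> conf C (Suc N)" by (simp add: core_def)
  show "x \<in> (\<Union>c\<in>C. cyl C N c)"
  proof (cases "\<exists>c. x c N \<noteq> 0")
    case False
    then have "x \<in> cyl C N (Min C)" using x by (auto simp: cyl_def)
    then show ?thesis using assms Min_in by blast
  next
    case True
    then obtain c where c: "x c N \<noteq> 0" by blast
    then have pos: "0 < x c N" and cC: "c \<in> C" using confD(1,2)[OF xc, of c N] by auto
    have "x d N = 0" if "d \<noteq> c" for d using confD(5)[OF xc that, of N] c by auto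
    moreover have "x \<notin> word_cell w" if "c \<noteq> Min C" "w \<in> removed_words C N" for w
    proof
      assume "x \<in> word_cell w"
      then have "x \<in> word_cell (c # w)" using pos that(2) by (simp only: in_word_cell_Cons removed_words_def) simp
      moreover have "c # w \<in> removed_words C (Suc N)"
        using that cC by (auto simp: removed_words_def insert_absorb)
      ultimately show False using x unfolding core_def by blast
    qed
    ultimately have "x \<in> cyl C N c" using x by (auto simp: cyl_def)
    then show ?thesis using cC by blast
  qed
qed (auto simp: cyl_def)

text \<open>The projection of \<open>hep_remove_cells\<close> again, with \<open>x c N\<close> in
  the role of the depth: the base has \<open>x c N = 0\<close>, and row \<open>c\<close> is pushed
  away from the last vertex while its other entries are rescaled so that the row sum stays 1.
  Supports never grow, hence the image stays in the cylinder.\<close>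

lemma cyl_hep:
  assumes "c \<noteq> Min C"
  shows "hep (cyl C N c) (core C N)"
proof -
  define f where "f = (\<lambda>(t::real) (x::nat \<Rightarrow> nat \<Rightarrow> real). (\<lambda>d j. if d = c then
      if j = N then 1 - (1 - x c N) / (1 - min (x c N) (t/2)) else x c j / (1 - min (x c N) (t/2))
      else x d j))"
  define r where "r = (\<lambda>z::real \<times> (nat \<Rightarrow> nat \<Rightarrow> real). (max 0 (fst z - 2 * snd z c N), f (fst z) (snd z)))"
  let ?Z = "cyl C N c"
  have AZ: "core C N \<subseteq> ?Z" using cyl_Int[of "Min C" c C N] assms by blast
  have "continuous_on ({0..1} \<times> ?Z) (\<lambda>z. f (fst z) (snd z) d j)" for d j
  proof -
    have nz: "\<forall>z\<in>{0..1::real} \<times> ?Z. 1 - min (snd z c N) (fst z / 2) \<noteq> 0" by (auto simp: min_def)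
    show ?thesis
      unfolding f_def by (cases "d = c"; cases "j = N"; simp; intro continuous_intros nz; simp)
  qed
  then have fcont: "continuous_on ({0..1} \<times> ?Z) (\<lambda>z. f (fst z) (snd z))" by (rule continuous_on_entries)
  have cont: "continuous_on ({0..1} \<times> ?Z) r"
    unfolding r_def by (rule continuous_on_Pair[OF _ fcont]) (intro continuous_intros)
  have "f t x \<in> ?Z \<and> (2 * x c N < t \<longrightarrow> f t x \<in> core C N)" if "t \<in> {0..1}" "x \<in> ?Z" for t x
  proof -
    have x: "x \<in> conf C (Suc N)" "\<And>d. d \<noteq> c \<Longrightarrow> x d N = 0"
      using that by (auto simp: cyl_def core_def)
    let ?m = "min (x c N) (t/2)"
    have m: "0 \<le> ?m" "?m < 1" "?m \<le> x c N" using that(1) confD(1)[OF x(1), of c N] by auto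
    have fN: "f t x c N = (x c N - ?m) / (1 - ?m)"
      using m by (simp add: f_def field_simps)
    have nonneg: "0 \<le> f t x d j" for d j
      using m confD(1)[OF x(1)] fN by (cases "d = c"; cases "j = N") (auto simp: f_def)
    have pos: "0 < x d j" if "0 < f t x d j" for d j
    proof (rule ccontr)
      assume "\<not> 0 < x d j"
      then have "x d j = 0" using confD(1)[OF x(1), of d j] by simp
      then show False using that m(1) fN by (cases "d = c"; cases "j = N") (auto simp: f_def min_def)
    qed
    have zero: "f t x d j = 0" if "x d j = 0" for d j
      using pos[of d j] nonneg[of d j] that by force
    have sum: "(\<Sum>j<Suc N. f t x d j) = 1" if "d \<in> C" for d
    proof (cases "d = c")
      case True
      have "(\<Sum>j<N. f t x c j) = (\<Sum>j<N. x c j) / (1 - ?m)"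
        by (simp add: f_def sum_divide_distrib)
      then have "(\<Sum>j<Suc N. f t x c j) = ((\<Sum>j<N. x c j) + x c N - ?m) / (1 - ?m)"
        using fN by (simp add: add_divide_distrib diff_divide_distrib)
      moreover have "(\<Sum>j<N. x c j) + x c N = 1"
        using confD(4)[OF x(1) that] True by simp
      ultimately show ?thesis using m(2) True by simp
    next
      case False
      then show ?thesis using confD(4)[OF x(1) that] by (simp add: f_def)
    qed
    have conf: "f t x \<in> conf C (Suc N)"
      unfolding conf_def using nonneg sum zero confD(2,3,5)[OF x(1)] by (auto; metis)
    have notin: "f t x \<notin> word_cell w" if "x \<notin> word_cell w" for w
      using that word_cell_mono[of "f t x" w x] pos by blast
    have fZ: "f t x \<in> ?Z"
      using that(2) conf notin zero unfolding cyl_def core_def by auto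
    moreover have "f t x \<in> core C N" if "2 * x c N < t"
    proof -
      have "f t x c N = 0" using that fN by simp
      then have "\<forall>d. f t x d N = 0" using zero x(2) by metis
      then have "f t x \<in> conf C N" using conf conf_sub_Suc by blast
      then show ?thesis using fZ assms unfolding cyl_def core_def[of C N] by blast
    qed
    ultimately show ?thesis by blast
  qed
  note fZ = this
  have nn: "0 \<le> x c N" if "x \<in> ?Z" for x
    using that confD(1)[of x C "Suc N"] by (auto simp: cyl_def core_def)
  have "r (t, x) \<in> {0} \<times> ?Z \<union> {0..1} \<times> core C N" if "t \<in> {0..1}" "x \<in> ?Z" for t x
    using fZ[OF that] nn[OF that(2)] that(1) by (auto simp: r_def max_def)
  then have "r \<in> {0..1} \<times> ?Z \<rightarrow> {0} \<times> ?Z \<union> {0..1} \<times> core C N" by blast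
  moreover have "r (0, x) = (0, x)" if "x \<in> ?Z" for x
  proof -
    show ?thesis using nn[OF that] by (auto simp: r_def f_def fun_eq_iff)
  qed
  moreover have "r (t, x) = (t, x)" if "x \<in> core C N" "t \<in> {0..1}" for t x
    using core_sub_core_Suc(2)[OF that(1), of c] that(2) by (auto simp: r_def f_def fun_eq_iff)
  ultimately show ?thesis
    unfolding hep_def using AZ cont by (intro conjI exI[of _ r]) auto
qed

text \<open>Move row \<open>c\<close> straight to the last vertex. The end of this deformation is a
  copy of \<open>core (C - {c}) N\<close>, with \<open>p\<close> inserting the row concentrated at
  the last vertex and \<open>q\<close> deleting it.\<close>

lemma cyl_contractible:
  assumes C: "finite C" "c \<in> C" and c: "c = Min C \<or> card C \<le> N"
    and IH: "contractible (core (C - {c}) N)" "core (C - {c}) N \<noteq> {}"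
  shows "contractible (cyl C N c)" "cyl C N c \<noteq> {}"
proof -
  let ?Z = "cyl C N c"
  define p where "p = (\<lambda>z::nat \<Rightarrow> nat \<Rightarrow> real. (\<lambda>d j. if d = c then if j = N then 1 else 0 else z d j))"
  define q where "q = (\<lambda>z::nat \<Rightarrow> nat \<Rightarrow> real. (\<lambda>d j. if d = c then 0 else z d j))"
  have zc: "z c j = 0" if "z \<in> core (C - {c}) N" for z j
    using that confD(2)[of z "C - {c}" N c j] by (auto simp: core_def)
  have pcont: "continuous_on (core (C - {c}) N) p"
    unfolding p_def by (rule continuous_on_entries, case_tac "d = c"; case_tac "j = N"; simp; intro continuous_intros)
  have qcont: "continuous_on S q" for S
    unfolding q_def by (rule continuous_on_entries, case_tac "d = c"; simp; intro continuous_intros)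
  have qp: "q (p z) = z" if "z \<in> core (C - {c}) N" for z
    using zc[OF that] by (auto simp: p_def q_def fun_eq_iff)
  have E: "contractible (p ` core (C - {c}) N)"
    by (rule contractible_homeomorphic_image[OF IH(1) pcont, of q]) (use qcont qp in auto)
  have pZ: "p z \<in> ?Z" if "z \<in> core (C - {c}) N" for z
  proof -
    have z: "z \<in> conf (C - {c}) N" using that by (simp add: core_def)
    have "p z \<in> conf C (Suc N)"
      unfolding conf_def using confD[OF z] C(2) by (auto simp: p_def)
    moreover have "p z \<notin> word_cell w" if w: "w \<in> removed_words C (Suc N)" for w
    proof
      assume "p z \<in> word_cell w"
      obtain b v where bv: "w = b # v" "length v = N" using w by (cases w) (auto simp: removed_words_def)
      have pv: "0 < p z b N" "p z \<in> word_cell v"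
        using \<open>p z \<in> word_cell w\<close> bv by (simp_all only: in_word_cell_Cons)
      have "b = c" using pv(1) confD(3)[OF z, of N b] by (auto simp: p_def split: if_splits)
      have "c \<notin> set v"
        using in_word_cell_support[OF pv(2), of c] bv(2) by (force simp: p_def)
      then have "set v = C - {c}" using w bv \<open>b = c\<close> by (auto simp: removed_words_def)
      \<comment> \<open>A distinct \<open>v\<close> would give \<open>N = card C - 1\<close>,
        against \<open>card C \<le> N\<close>. So the clause of \<open>removed\<close> with
        \<open>distinct\<close> cannot be the reason why \<open>c # v\<close> is removed.\<close>
      moreover have "\<not> distinct v" if "c \<noteq> Min C"
        using c that C \<open>set v = C - {c}\<close> bv(2) distinct_card[of v] card_Suc_Diff1[OF C] by auto
      then have "removed v" using w bv \<open>b = c\<close> \<open>c \<notin> set v\<close> by (auto simp: removed_words_def)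
      moreover have "z \<in> word_cell v"
        using bv(2) by (intro word_cell_mono[OF pv(2)]) (auto simp: p_def split: if_splits)
      ultimately show False using \<open>z \<in> core (C - {c}) N\<close> bv(2) by (auto simp: core_def removed_words_def)
    qed
    moreover have "p z \<notin> word_cell w" if w: "w \<in> removed_words C N" for w
    proof
      assume *: "p z \<in> word_cell w"
      have "c \<in> set w" "length w = N" using w C by (auto simp: removed_words_def)
      then show False using in_word_cell_support[OF *, of c] by (force simp: p_def)
    qed
    moreover have "p z d N = 0" if "d \<noteq> c" for d
      using that confD(3)[OF z, of N d] by (simp add: p_def)
    ultimately show ?thesis by (auto simp: cyl_def core_def)
  qed
  then show "?Z \<noteq> {}" using IH(2) by blast
  have qZ: "x \<in> p ` core (C - {c}) N" if "x \<in> ?Z" "x c N = 1" for x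
  proof -
    have x: "x \<in> conf C (Suc N)" "\<And>d. d \<noteq> c \<Longrightarrow> x d N = 0"
      using that by (auto simp: cyl_def core_def)
    have "(\<Sum>j<N. x c j) = 0" using confD(4)[OF x(1) C(2)] that(2) by simp
    then have 0: "x c j = 0" if "j \<noteq> N" for j
      using confD(1,3)[OF x(1)] that by (cases "j < N") (auto simp: sum_nonneg_eq_0_iff)
    have x_eq: "x = p (q x)" using 0 that(2) by (auto simp: p_def q_def fun_eq_iff)
    have "q x d N = 0" for d using x(2) by (simp add: q_def)
    moreover have "q x \<in> conf (C - {c}) (Suc N)"
      unfolding conf_def using confD[OF x(1)] by (auto simp: q_def simp del: sum.lessThan_Suc)
    ultimately have "q x \<in> conf (C - {c}) N" using conf_sub_Suc by blast
    moreover have "q x \<notin> word_cell w" if w: "w \<in> removed_words (C - {c}) N" for w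
    proof
      assume *: "q x \<in> word_cell w"
      have "x \<in> word_cell w" by (intro word_cell_mono[OF *]) (auto simp: q_def split: if_splits)
      moreover have "0 < x c (length w)" using w \<open>x c N = 1\<close> by (auto simp: removed_words_def)
      ultimately have "x \<in> word_cell (c # w)" by (simp only: in_word_cell_Cons)
      moreover have "c # w \<in> removed_words C (Suc N)" using w C by (auto simp: removed_words_def)
      ultimately show False using \<open>x \<in> ?Z\<close> unfolding cyl_def core_def by blast
    qed
    ultimately have "q x \<in> core (C - {c}) N" by (auto simp: core_def)
    then show ?thesis using x_eq by blast
  qed
  define H where "H = (\<lambda>z::real \<times> (nat \<Rightarrow> nat \<Rightarrow> real). (\<lambda>d j. if d = c then
     (1 - fst z) * snd z c j + (if j = N then fst z else 0) else snd z d j))"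
  show "contractible ?Z"
  proof (rule contractible_retract[OF _ _ _ _ _ E])
    show "continuous_on ({0..1} \<times> ?Z) H"
      unfolding H_def by (rule continuous_on_entries, case_tac "d = c"; case_tac "j = N"; simp; intro continuous_intros)
    show HZ: "H \<in> {0..1} \<times> ?Z \<rightarrow> ?Z"
    proof
      fix z assume "z \<in> {0..1::real} \<times> ?Z"
      then obtain t x where z: "z = (t, x)" and t: "0 \<le> t" "t \<le> 1" and xZ: "x \<in> ?Z" by auto
      define y where "y = H (t, x)"
      have x: "x \<in> conf C (Suc N)" "\<And>d. d \<noteq> c \<Longrightarrow> x d N = 0"
        using xZ by (auto simp: cyl_def core_def)
      have sum: "(\<Sum>j<Suc N. y d j) = 1" if "d \<in> C" for d
      proof (cases "d = c")
        case True
        have "(\<Sum>j<Suc N. y d j) = (1 - t) * (\<Sum>j<Suc N. x c j) + t"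
          by (simp add: y_def H_def True sum_distrib_left distrib_left)
        then show ?thesis using confD(4)[OF x(1) that] True by simp
      qed (use confD(4)[OF x(1) that] in \<open>simp add: y_def H_def\<close>)
      have pos: "0 < x d j" if "0 < y d j" "d \<noteq> c \<or> j \<noteq> N" for d j
        using that t confD(1)[OF x(1), of d j] by (auto simp: y_def H_def zero_less_mult_iff split: if_splits)
      have nonneg: "0 \<le> y d j" for d j using t confD(1)[OF x(1)] by (auto simp: y_def H_def)
      have zero: "y d j = 0" if "x d j = 0" "d \<noteq> c \<or> j \<noteq> N" for d j
        using pos[of d j] nonneg[of d j] that by force
      have disj: "y d j = 0 \<or> y e j = 0" if "d \<noteq> e" for d e j
      proof (cases "j = N")
        case True then show ?thesis using x(2) zero that by metis
      next
        case False then show ?thesis using confD(5)[OF x(1) that, of j] zero by blast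
      qed
      have conf: "y \<in> conf C (Suc N)"
        unfolding conf_def using nonneg sum disj confD(2,3)[OF x(1)] zero C(2) by (auto; metis Suc_n_not_le_n)
      have yN: "y d N = 0" if "d \<noteq> c" for d using zero x(2) that by blast
      have lower: "x \<in> word_cell w" if "y \<in> word_cell w" "length w = N" for w
        using that pos by (intro word_cell_mono[OF that(1)]) auto
      have "y \<notin> word_cell w" if w: "w \<in> removed_words C (Suc N)" for w
      proof
        assume "y \<in> word_cell w"
        obtain b v where bv: "w = b # v" "length v = N" using w by (cases w) (auto simp: removed_words_def)
        have yv: "0 < y b N" "y \<in> word_cell v"
          using \<open>y \<in> word_cell w\<close> bv by (simp_all only: in_word_cell_Cons)
        have "b = c" using yv(1) yN[of b] by auto
        have xv: "x \<in> word_cell v" using lower yv(2) bv(2) by blast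
        show False
        proof (cases "c \<in> set v")
          case True
          then have "v \<in> removed_words C N" "c \<noteq> Min C"
            using w bv \<open>b = c\<close> by (auto simp: removed_words_def insert_absorb)
          then show False using xZ xv by (auto simp: cyl_def)
        next
          \<comment> \<open>Here the other colours occupy all of the first \<open>N\<close>
            vertices, so row \<open>c\<close> already sits at the last vertex. The homotopy has not
            moved it, and \<open>x\<close> itself would lie in the removed cell.\<close>
          case False
          have "x c j = 0" if "j < N" for j
          proof -
            have "rev v ! j \<noteq> c" using False that bv(2) by (metis length_rev nth_mem set_rev)
            then show ?thesis
              using confD(5)[OF x(1), of "rev v ! j" c j] xv that bv(2) by (auto simp: open_cell_def)
          qed
          then have "x c N = 1" using confD(4)[OF x(1) C(2)] by simp
          then have "x \<in> word_cell w" using xv bv \<open>b = c\<close> by (simp only: in_word_cell_Cons) simp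
          then show False using xZ w by (auto simp: cyl_def core_def)
        qed
      qed
      moreover have "y \<notin> word_cell w" if "c \<noteq> Min C" "w \<in> removed_words C N" for w
        using lower[of w] that xZ by (auto simp: cyl_def removed_words_def)
      ultimately show "H z \<in> ?Z" using conf yN z by (auto simp: cyl_def core_def y_def)
    qed
    show "H (0, x) = x" for x by (auto simp: H_def fun_eq_iff)
    show "p ` core (C - {c}) N \<subseteq> ?Z" using pZ by blast
    show "p ` core (C - {c}) N \<noteq> {}" using IH(2) by blast
    show "H (1, x) \<in> p ` core (C - {c}) N" if "x \<in> ?Z" for x
      using that funcset_mem[OF HZ, of "(1, x)"] by (intro qZ) (auto simp: H_def)
  qed
qed

text \<open>Each colour needs a vertex of its own, so with as many colours as vertices
  \<open>f\<close> is a bijection and its inverse spells a word without repetitions. If its head is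
  not \<open>Min C\<close>, the clause with \<open>distinct\<close> removes the cell.\<close>

lemma core_Suc_card:
  assumes "finite C" "card C = Suc N"
  shows "core C (Suc N) = cyl C N (Min C)"
proof (intro equalityI subsetI)
  fix x assume x: "x \<in> core C (Suc N)"
  have ne: "C \<noteq> {}" using assms by auto
  have xc: "x \<in> conf C (Suc N)" using x by (simp add: core_def)
  have "x c N = 0" if "c \<noteq> Min C" for c
  proof (rule ccontr)
    assume c: "x c N \<noteq> 0"
    have "\<exists>j<Suc N. x d j > 0" if "d \<in> C" for d
    proof (rule ccontr)
      assume "\<not> ?thesis"
      then have "x d j = 0" if "j < Suc N" for j
        using that confD(1)[OF xc, of d j] by fastforce
      then have "(\<Sum>j<Suc N. x d j) = 0" by (intro sum.neutral) blast
      then show False using confD(4)[OF xc that] by simp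
    qed
    then obtain f where f: "\<And>d. d \<in> C \<Longrightarrow> f d < Suc N \<and> x d (f d) > 0" by metis
    have inj: "inj_on f C"
      using f confD(5)[OF xc] by (intro inj_onI) (metis less_irrefl)
    have "f ` C = {..<Suc N}"
      using inj f assms by (intro card_subset_eq) (auto simp: card_image)
    then have bij: "bij_betw (inv_into C f) {..<Suc N} C"
      using inj by (metis bij_betw_def bij_betw_inv_into)
    define g where "g = inv_into C f"
    have g: "g j \<in> C" "0 < x (g j) j" if "j < Suc N" for j
    proof -
      have j: "j \<in> f ` C" using that \<open>f ` C = {..<Suc N}\<close> by simp
      show "g j \<in> C" unfolding g_def by (rule inv_into_into[OF j])
      then show "0 < x (g j) j" using f[of "g j"] f_inv_into_f[OF j] by (simp add: g_def)
    qed
    have "g N = c" using g(2)[of N] confD(5)[OF xc, of c "g N" N] c by auto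
    define v where "v = rev (map g [0..<N])"
    have gv: "rev (c # v) = map g [0..<Suc N]" using \<open>g N = c\<close> by (simp add: v_def)
    have "length (c # v) = Suc N" by (simp add: v_def)
    have "x \<in> word_cell (c # v)"
      unfolding open_cell_def gv using g(2) \<open>length (c # v) = Suc N\<close>
      by (simp del: upt_Suc)
    have "set (rev (c # v)) = C" unfolding gv using bij by (auto simp: bij_betw_def g_def atLeast0LessThan simp del: upt_Suc)
    then have setv: "set (c # v) = C" by simp
    have "distinct (rev (c # v))" unfolding gv using bij by (auto simp: bij_betw_def g_def distinct_map atLeast0LessThan simp del: upt_Suc)
    then have "distinct (c # v)" by simp
    then have "removed (c # v)" using that setv by auto
    then have "c # v \<in> removed_words C (Suc N)" using setv \<open>length (c # v) = Suc N\<close> by (simp add: removed_words_def)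
    then show False using x \<open>x \<in> word_cell (c # v)\<close> unfolding core_def by blast
  qed
  then show "x \<in> cyl C N (Min C)" using x by (auto simp: cyl_def)
qed (auto simp: cyl_def)

lemma contractible_singleton: "contractible {a}" for a :: "'a::topological_space"
  unfolding contractible_def
  by (intro exI[of _ a] homotopic_with_canonI[of _ "\<lambda>_. a"]) (auto intro: continuous_on_const)

text \<open>The induction on \<open>N\<close> treats all colour sets at once, because the ends of
  the cylinders have one colour less. For \<open>card C = Suc N\<close> there is no base to glue
  along, but then a single cylinder is left.\<close>

lemma core_contractible:
  assumes "finite C" "card C \<le> N"
  shows "contractible (core C N) \<and> core C N \<noteq> {}"
  using assms
proof (induction N arbitrary: C)
  case 0
  then show ?case by (simp add: core_empty contractible_singleton)
next
  case (Suc N)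
  show ?case
  proof (cases "C = {}")
    case True then show ?thesis by (simp add: core_empty contractible_singleton)
  next
    case False
    have cyl: "contractible (cyl C N c)" "cyl C N c \<noteq> {}" if "c \<in> C" "c = Min C \<or> card C \<le> N" for c
    proof -
      have "card (C - {c}) \<le> N" using Suc.prems that by (simp add: card_Diff_singleton)
      then have "contractible (core (C - {c}) N) \<and> core (C - {c}) N \<noteq> {}"
        using Suc.IH[of "C - {c}"] Suc.prems(1) by simp
      then show "contractible (cyl C N c)" "cyl C N c \<noteq> {}"
        using cyl_contractible[OF Suc.prems(1) that] by auto
    qed
    have min: "Min C \<in> C" using False Suc.prems by simp
    show ?thesis
    proof (cases "card C = Suc N")
      case True
      then show ?thesis using core_Suc_card[OF Suc.prems(1) True] cyl[OF min] by simp
    next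
      case neq: False
      then have le: "card C \<le> N" using Suc.prems by simp
      have base: "contractible (core C N)" "core C N \<noteq> {}" using Suc.IH[OF Suc.prems(1) le] by auto
      \<comment> \<open>Cylinders are attached one at a time. Since each pair of them meets in
        \<open>core C N\<close>, a new cylinder also meets the union of the earlier ones in exactly
        this set.\<close>
      have "contractible (cyl C N (Min C) \<union> (\<Union>c\<in>F. cyl C N c))"
        if "finite F" "F \<subseteq> C - {Min C}" for F
        using that
      proof (induction F rule: finite_induct)
        case empty
        then show ?case using cyl[OF min] by simp
      next
        case (insert d F)
        let ?P = "cyl C N (Min C) \<union> (\<Union>c\<in>F. cyl C N c)"
        have d: "d \<in> C" "d \<noteq> Min C" using insert.prems by auto
        have int: "?P \<inter> cyl C N d = core C N"
        proof (intro equalityI subsetI)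
          fix x assume "x \<in> ?P \<inter> cyl C N d"
          then obtain c where c: "c \<in> insert (Min C) F" "x \<in> cyl C N c" "x \<in> cyl C N d" by auto
          then have "c \<noteq> d" using d(2) insert.hyps(2) by auto
          then show "x \<in> core C N" using cyl_Int[of c d C N] d(2) c by auto
        qed (use cyl_Int[of "Min C" d C N] d(2) in blast)
        have "contractible (?P \<union> cyl C N d)"
        proof (rule contractible_glue)
          show "closed ?P" using insert.hyps(1) by (intro closed_Un closed_UN ballI closed_cyl)
          show "contractible ?P" using insert by auto
        qed (use cyl[OF d(1)] le closed_cyl base cyl_hep[OF d(2)] in \<open>simp_all add: int\<close>)
        then show ?case by (simp add: Un_ac)
      qed
      from this[of "C - {Min C}"] have "contractible (cyl C N (Min C) \<union> (\<Union>c\<in>C - {Min C}. cyl C N c))"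
        using Suc.prems by simp
      moreover have "cyl C N (Min C) \<union> (\<Union>c\<in>C - {Min C}. cyl C N c) = core C (Suc N)"
        unfolding core_Suc_eq[OF Suc.prems(1) False] using min by blast
      ultimately show ?thesis using core_sub_core_Suc(1)[of _ C N] base(2) by auto
    qed
  qed
qed

section \<open>Top cells modulo their boundary are spheres\<close>

definition unit_sphere :: "nat \<Rightarrow> (nat \<Rightarrow> real) set" where
  "unit_sphere d = {x. (\<Sum>i\<le>d. (x i)\<^sup>2) = 1 \<and> (\<forall>i>d. x i = 0)}"

lemma sum_atMost_split: "(\<Sum>i\<le>d. f i) = f 0 + (\<Sum>i=1..d. f i)" for f :: "nat \<Rightarrow> real"
  by (simp add: atMost_atLeast0 sum.atLeast_Suc_atMost)

lemma nsphere_basepoint_in_sphere: "nsphere_basepoint \<in> unit_sphere d"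
  by (auto simp: unit_sphere_def nsphere_basepoint_def sum_atMost_split)

lemma sphere_eq_basepoint:
  assumes "y \<in> unit_sphere d" "y 0 = 1" shows "y = nsphere_basepoint"
proof
  fix i
  have "(\<Sum>i=1..d. (y i)\<^sup>2) = 0"
    using assms unfolding unit_sphere_def sum_atMost_split by simp
  then have "\<forall>i\<in>{1..d}. (y i)\<^sup>2 = 0" by (subst (asm) sum_nonneg_eq_0_iff) auto
  then show "y i = nsphere_basepoint i"
    using assms by (cases "i = 0"; cases "i \<le> d") (auto simp: unit_sphere_def nsphere_basepoint_def)
qed

text \<open>This is inverse stereographic projection of \<open>u\<close> from the basepoint, where
  coordinate 0 equals 1; that coordinate tends to 1 as \<open>u\<close> goes to infinity.\<close>

lemma stereographic_on_sphere:
  fixes u :: "nat \<Rightarrow> real" and d :: nat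
  defines "r \<equiv> (\<Sum>i=1..d. (u i)\<^sup>2)"
  shows "((r - 1) / (r + 1))\<^sup>2 + (\<Sum>i=1..d. (2 * u i / (r + 1))\<^sup>2) = 1"
proof -
  have "0 \<le> r" unfolding r_def by (intro sum_nonneg) auto
  have "(\<Sum>i=1..d. (2 * u i / (r + 1))\<^sup>2) = (\<Sum>i=1..d. (u i)\<^sup>2 * (4 / (r + 1)\<^sup>2))"
    by (intro sum.cong) (auto simp: power_divide power_mult_distrib)
  also have "\<dots> = r * (4 / (r + 1)\<^sup>2)" unfolding r_def by (rule sum_distrib_right[symmetric])
  also have "\<dots> = 4 * r / (r + 1)\<^sup>2" by simp
  finally show ?thesis
    using \<open>0 \<le> r\<close> by (simp add: power_divide flip: add_divide_distrib) (simp add: power2_eq_square algebra_simps)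
qed

text \<open>A leader is the least vertex of its block. The deviations of the entries at the nonleaders from the
  barycenter are coordinates of the cell.\<close>

definition nonleaders :: "(nat \<Rightarrow> nat) \<Rightarrow> nat \<Rightarrow> nat set" where
  "nonleaders \<alpha> N = {j. j < N \<and> (\<exists>i<j. \<alpha> i = \<alpha> j)}"

text \<open>Each colour in use has exactly one leader, so the leaders are in bijection with the
  colours.\<close>

lemma card_nonleaders: "card (nonleaders \<alpha> N) = N - card (\<alpha> ` {..<N})"
proof -
  let ?L = "{..<N} - nonleaders \<alpha> N"
  have inj: "inj_on \<alpha> ?L"
    by (rule inj_onI) (auto simp: nonleaders_def, metis linorder_neqE_nat)
  have "\<alpha> ` {..<N} \<subseteq> \<alpha> ` ?L"
  proof
    fix c assume "c \<in> \<alpha> ` {..<N}"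
    then obtain j where "j < N" "\<alpha> j = c" by auto
    define l where "l = (LEAST i. \<alpha> i = c)"
    have "\<alpha> l = c" "l \<le> j" unfolding l_def using \<open>\<alpha> j = c\<close> by (auto intro: LeastI Least_le)
    moreover have "\<alpha> i \<noteq> c" if "i < l" for i using that not_less_Least unfolding l_def by blast
    ultimately have "l \<in> ?L" using \<open>j < N\<close> by (auto simp: nonleaders_def)
    then show "c \<in> \<alpha> ` ?L" using \<open>\<alpha> l = c\<close> by blast
  qed
  then have "\<alpha> ` {..<N} = \<alpha> ` ?L" by blast
  then have "card (\<alpha> ` {..<N}) = card ?L" using card_image[OF inj] by simp
  also have "\<dots> = N - card (nonleaders \<alpha> N)"
    by (subst card_Diff_subset) (auto simp: nonleaders_def)
  finally have "card (\<alpha> ` {..<N}) = N - card (nonleaders \<alpha> N)" .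
  moreover have "card (nonleaders \<alpha> N) \<le> N"
    using card_mono[of "{..<N}" "nonleaders \<alpha> N"] by (auto simp: nonleaders_def)
  ultimately show ?thesis by simp
qed

lemma block_leader:
  assumes "j < N" "j \<notin> nonleaders \<alpha> N"
  shows "{i. i < N \<and> \<alpha> i = \<alpha> j} = insert j {i \<in> nonleaders \<alpha> N. \<alpha> i = \<alpha> j}"
  using assms by (auto simp: nonleaders_def) (metis linorder_neqE_nat)

text \<open>On the vertices below \<open>N\<close>, this is the only extension of the values at the
  nonleaders whose sum over every block is zero: the leader compensates for the rest of its
  block.\<close>

definition balance :: "(nat \<Rightarrow> nat) \<Rightarrow> nat \<Rightarrow> (nat \<Rightarrow> real) \<Rightarrow> nat \<Rightarrow> real" where
  "balance \<alpha> N u j =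
     (if j \<in> nonleaders \<alpha> N then u j else - (\<Sum>i \<in> {i \<in> nonleaders \<alpha> N. \<alpha> i = \<alpha> j}. u i))"

lemma finite_nonleaders: "finite (nonleaders \<alpha> N)"
  by (simp add: nonleaders_def)

lemma sum_balance: "(\<Sum>i | i < N \<and> \<alpha> i = \<alpha> j. balance \<alpha> N u i) = 0" if "j < N" 
proof -
  define l where "l = (LEAST i. \<alpha> i = \<alpha> j)"
  have l: "\<alpha> l = \<alpha> j" "l \<le> j" unfolding l_def by (auto intro: LeastI Least_le)
  moreover have "\<alpha> i \<noteq> \<alpha> j" if "i < l" for i using that not_less_Least unfolding l_def by blast
  ultimately have lN: "l < N" "l \<notin> nonleaders \<alpha> N" using that by (auto simp: nonleaders_def)
  have "(\<Sum>i | i < N \<and> \<alpha> i = \<alpha> l. balance \<alpha> N u i) =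
      balance \<alpha> N u l + (\<Sum>i \<in> {i \<in> nonleaders \<alpha> N. \<alpha> i = \<alpha> l}. balance \<alpha> N u i)"
    unfolding block_leader[OF lN] using lN finite_nonleaders by (subst sum.insert) auto
  also have "(\<Sum>i \<in> {i \<in> nonleaders \<alpha> N. \<alpha> i = \<alpha> l}. balance \<alpha> N u i) =
      (\<Sum>i \<in> {i \<in> nonleaders \<alpha> N. \<alpha> i = \<alpha> l}. u i)"
    by (intro sum.cong) (auto simp: balance_def)
  finally show ?thesis using lN l(1) by (simp add: balance_def)
qed

lemma balanced_eq:
  assumes "j < N" "(\<Sum>i | i < N \<and> \<alpha> i = \<alpha> j. v i) = 0"
  shows "v j = balance \<alpha> N v j"
proof (cases "j \<in> nonleaders \<alpha> N")
  case False
  have "v j + (\<Sum>i \<in> {i \<in> nonleaders \<alpha> N. \<alpha> i = \<alpha> j}. v i) = 0"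
    using assms(2) unfolding block_leader[OF assms(1) False]
    using False finite_nonleaders by (subst (asm) sum.insert) auto
  then show ?thesis using False by (simp add: balance_def)
qed (simp add: balance_def)

lemma balance_cong:
  "(\<And>i. i \<in> nonleaders \<alpha> N \<Longrightarrow> u i = v i) \<Longrightarrow> balance \<alpha> N u j = balance \<alpha> N v j"
  unfolding balance_def by (auto intro!: sum.cong)

lemma balance_scale: "balance \<alpha> N (\<lambda>i. r * u i) j = r * balance \<alpha> N u j"
  by (simp add: balance_def sum_distrib_left)

section \<open>The map from one top cell onto the sphere\<close>

locale top_cell =
  fixes C :: "nat set" and N :: nat and \<alpha> e :: "nat \<Rightarrow> nat"
  assumes N: "0 < N" and \<alpha>: "\<alpha> ` {..<N} = C"
    and e: "bij_betw e {1..N - card C} (nonleaders \<alpha> N)"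
begin

text \<open>Zero exactly on the closed cell. It is added to the squared radius in \<open>cell_map\<close> only to keep the
  denominator positive outside of the closed cell.\<close>

definition off :: "(nat \<Rightarrow> nat \<Rightarrow> real) \<Rightarrow> real" where
  "off x = (\<Sum>c\<in>C. \<Sum>j<N. if c = \<alpha> j then 0 else x c j)"

definition dev :: "(nat \<Rightarrow> nat \<Rightarrow> real) \<Rightarrow> nat \<Rightarrow> real" where
  "dev x j = x (\<alpha> j) j - 1 / block_size \<alpha> N (\<alpha> j)"

definition radius2 :: "(nat \<Rightarrow> nat \<Rightarrow> real) \<Rightarrow> real" where
  "radius2 x = (\<Sum>i=1..N - card C. (dev x (e i))\<^sup>2)"

text \<open>Inverse stereographic projection of \<open>dev x / depth x\<close>, cleared of denominators so that it extends
  continuously by the base point to points of depth zero.\<close>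

definition cell_map :: "(nat \<Rightarrow> nat \<Rightarrow> real) \<Rightarrow> nat \<Rightarrow> real" where
  "cell_map x i = (let s = depth \<alpha> N x; q = radius2 x + off x in
     if i = 0 then (q - s\<^sup>2) / (q + s\<^sup>2)
     else if i \<le> N - card C then 2 * s * dev x (e i) / (q + s\<^sup>2) else 0)"

lemma finite_C: "finite C" using \<alpha> by auto

lemma off_nonneg: "x \<in> conf C N \<Longrightarrow> 0 \<le> off x"
  unfolding off_def by (intro sum_nonneg) (auto dest: confD(1))

lemma radius2_nonneg: "0 \<le> radius2 x"
  unfolding radius2_def by (intro sum_nonneg) auto

lemma off_eq_0D:
  assumes "x \<in> conf C N" "off x = 0" "c \<noteq> \<alpha> j"
  shows "x c j = 0"
proof (cases "c \<in> C \<and> j < N")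
  case True
  have "(\<Sum>j<N. if c = \<alpha> j then 0 else x c j) = 0"
    using assms(2) True finite_C confD(1)[OF assms(1)] unfolding off_def
    by (subst (asm) sum_nonneg_eq_0_iff) (auto intro!: sum_nonneg)
  then have "(if c = \<alpha> j then 0 else x c j) = 0"
    using True confD(1)[OF assms(1)] by (subst (asm) sum_nonneg_eq_0_iff) auto
  then show ?thesis using assms(3) by simp
qed (use confD(2,3)[OF assms(1)] in auto)

lemma off_cell: "x \<in> conf C N \<Longrightarrow> x \<in> open_cell \<alpha> N \<Longrightarrow> off x = 0"
  unfolding off_def by (intro sum.neutral ballI) (auto dest: conf_open_cell_off)

lemma dev_balanced:
  assumes x: "x \<in> conf C N" "off x = 0" and j: "j < N"
  shows "dev x j = balance \<alpha> N (dev x) j"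
proof (rule balanced_eq[OF j])
  let ?B = "{i. i < N \<and> \<alpha> i = \<alpha> j}"
  have "(\<Sum>i<N. x (\<alpha> j) i) = (\<Sum>i<N. if \<alpha> i = \<alpha> j then x (\<alpha> j) i else 0)"
    using off_eq_0D[OF x] by (intro sum.cong) auto
  also have "\<dots> = (\<Sum>i\<in>?B. x (\<alpha> j) i)" by (rule sum_over_block)
  finally have 1: "(\<Sum>i\<in>?B. x (\<alpha> j) i) = 1" using confD(4)[OF x(1), of "\<alpha> j"] \<alpha> j by auto
  have "(\<Sum>i\<in>?B. dev x i) = (\<Sum>i\<in>?B. x (\<alpha> j) i - 1 / block_size \<alpha> N (\<alpha> j))"
    by (intro sum.cong) (auto simp: dev_def)
  also have "\<dots> = 1 - block_size \<alpha> N (\<alpha> j) * (1 / block_size \<alpha> N (\<alpha> j))"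
    using 1 by (simp add: sum_subtractf block_size_def)
  also have "\<dots> = 0" using block_size_ge_1[OF j, of \<alpha>] by simp
  finally show "(\<Sum>i\<in>?B. dev x i) = 0" .
qed

text \<open>If all three terms vanished, the point would lie on the closed cell with zero deviation
  at the nonleaders, hence everywhere by balance. It would be the barycenter, whose depth is
  positive.\<close>

lemma denom_pos:
  assumes x: "x \<in> conf C N" shows "0 < radius2 x + off x + (depth \<alpha> N x)\<^sup>2"
proof (rule ccontr)
  assume "\<not> ?thesis"
  then have "radius2 x = 0 \<and> off x = 0 \<and> (depth \<alpha> N x)\<^sup>2 = 0"
    using radius2_nonneg[of x] off_nonneg[OF x] zero_le_power2[of "depth \<alpha> N x"] by linarith
  then have 0: "radius2 x = 0" "off x = 0" "depth \<alpha> N x = 0" by simp_all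
  have "dev x (e i) = 0" if "i \<in> {1..N - card C}" for i
    using 0(1) that unfolding radius2_def by (subst (asm) sum_nonneg_eq_0_iff) auto
  then have "dev x j = 0" if "j \<in> nonleaders \<alpha> N" for j
    using e that by (metis bij_betw_def imageE)
  then have "balance \<alpha> N (dev x) j = 0" for j by (auto simp: balance_def)
  then have "dev x j = 0" if "j < N" for j
    using dev_balanced[OF x 0(2) that] by simp
  then have "0 < x (\<alpha> j) j" if "j < N" for j
    using block_size_ge_1[OF that, of \<alpha>] that by (fastforce simp: dev_def)
  then have "x \<in> open_cell \<alpha> N" by (simp add: open_cell_def)
  then show False using 0(3) depth_pos_iff[OF N, of \<alpha> x] by simp
qed

lemma continuous_on_cell_map: "continuous_on (conf C N) cell_map"
proof (rule continuous_on_coordinatewise_then_product)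
  fix i
  have dev: "continuous_on (conf C N) (\<lambda>x. dev x j)" for j
    unfolding dev_def by (intro continuous_intros)
  have rad: "continuous_on (conf C N) radius2"
    unfolding radius2_def by (intro continuous_intros dev)
  have off: "continuous_on (conf C N) off"
  proof -
    have "continuous_on (conf C N) (\<lambda>x. if c = \<alpha> j then 0 else x c j)" for c j
      by (cases "c = \<alpha> j"; simp; intro continuous_intros)
    then show ?thesis unfolding off_def by (intro continuous_on_sum)
  qed
  have nz: "\<forall>x\<in>conf C N. radius2 x + off x + (depth \<alpha> N x)\<^sup>2 \<noteq> 0" using denom_pos by force
  have dep: "continuous_on (conf C N) (depth \<alpha> N)" using continuous_on_depth[OF N continuous_on_id] by simp
  have 1: "continuous_on (conf C N) (\<lambda>x. (radius2 x + off x - (depth \<alpha> N x)\<^sup>2) / (radius2 x + off x + (depth \<alpha> N x)\<^sup>2))"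
    by (intro continuous_on_divide continuous_on_add continuous_on_diff continuous_on_power rad off dep nz)
  have 2: "continuous_on (conf C N) (\<lambda>x. 2 * depth \<alpha> N x * dev x (e i) / (radius2 x + off x + (depth \<alpha> N x)\<^sup>2))"
    by (intro continuous_on_divide continuous_on_add continuous_on_mult continuous_on_const continuous_on_power rad off dep dev nz)
  show "continuous_on (conf C N) (\<lambda>x. cell_map x i)"
    unfolding cell_map_def Let_def using 1 2 by (cases "i = 0"; cases "i \<le> N - card C") simp_all
qed

lemma cell_map_off_cell:
  assumes "x \<in> conf C N" "x \<notin> open_cell \<alpha> N" shows "cell_map x = nsphere_basepoint"
  using denom_pos[OF assms(1)] depth_eq_0[OF N assms]
  by (auto simp: cell_map_def nsphere_basepoint_def fun_eq_iff)

lemma cell_map_on_cell: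
  assumes "x \<in> conf C N" "x \<in> open_cell \<alpha> N"
  defines "s \<equiv> depth \<alpha> N x" and "r \<equiv> (\<Sum>i=1..N - card C. (dev x (e i) / depth \<alpha> N x)\<^sup>2)"
  shows "0 < s" "cell_map x 0 = (r - 1) / (r + 1)"
    "\<And>i. i \<in> {1..N - card C} \<Longrightarrow> cell_map x i = 2 * (dev x (e i) / s) / (r + 1)"
proof -
  show s: "0 < s" using depth_pos_iff[OF N] assms(2) s_def by simp
  have q: "radius2 x + off x = r * s\<^sup>2"
    using s off_cell[OF assms(1,2)] unfolding radius2_def r_def s_def[symmetric]
    by (simp add: sum_distrib_right power_divide)
  have den: "r * s\<^sup>2 + s\<^sup>2 = (r + 1) * s\<^sup>2" "r * s\<^sup>2 - s\<^sup>2 = (r - 1) * s\<^sup>2" by (simp_all add: algebra_simps)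
  have "0 \<le> r" unfolding r_def by (intro sum_nonneg) auto
  show "cell_map x 0 = (r - 1) / (r + 1)"
    unfolding cell_map_def Let_def q s_def[symmetric] den using s by simp
  show "cell_map x i = 2 * (dev x (e i) / s) / (r + 1)" if "i \<in> {1..N - card C}" for i
    unfolding cell_map_def Let_def q s_def[symmetric] den using s that by (simp add: power2_eq_square)
qed

lemma cell_map_in_sphere:
  assumes "x \<in> conf C N" shows "cell_map x \<in> unit_sphere (N - card C)"
proof (cases "x \<in> open_cell \<alpha> N")
  case True
  have "(\<Sum>i\<le>N - card C. (cell_map x i)\<^sup>2) = 1"
    unfolding sum_atMost_split cell_map_on_cell(2)[OF assms True]
    using stereographic_on_sphere[of "\<lambda>i. dev x (e i) / depth \<alpha> N x" "N - card C"]
    by (simp add: cell_map_on_cell(3)[OF assms True] del: One_nat_def)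
  then show ?thesis unfolding unit_sphere_def by (simp add: cell_map_def)
next
  case False
  then show ?thesis using cell_map_off_cell[OF assms] nsphere_basepoint_in_sphere by simp
qed

lemma cell_map_neq_basepoint:
  assumes "x \<in> conf C N" "x \<in> open_cell \<alpha> N" shows "cell_map x \<noteq> nsphere_basepoint"
proof -
  define r where "r = (\<Sum>i=1..N - card C. (dev x (e i) / depth \<alpha> N x)\<^sup>2)"
  have "0 \<le> r" unfolding r_def by (intro sum_nonneg) auto
  then have "cell_map x 0 < 1"
    unfolding cell_map_on_cell(2)[OF assms, folded r_def] by simp
  then show ?thesis by (auto simp: nsphere_basepoint_def)
qed

text \<open>The stereographic formula determines the deviations divided by the depth, at the
  nonleaders and then at all vertices by balance. This fixes the ray from the barycenter, and along
  a ray the depth fixes the point.\<close>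

lemma cell_map_inj: "inj_on cell_map (conf C N \<inter> open_cell \<alpha> N)"
proof (rule inj_onI)
  fix x y assume xc: "x \<in> conf C N \<inter> open_cell \<alpha> N" and yc: "y \<in> conf C N \<inter> open_cell \<alpha> N"
    and eq: "cell_map x = cell_map y"
  have scaled: "dev x j / depth \<alpha> N x = dev y j / depth \<alpha> N y" if "j < N" for j
  proof -
    define rx where "rx = (\<Sum>i=1..N - card C. (dev x (e i) / depth \<alpha> N x)\<^sup>2)"
    define ry where "ry = (\<Sum>i=1..N - card C. (dev y (e i) / depth \<alpha> N y)\<^sup>2)"
    have nn: "0 \<le> rx" "0 \<le> ry" unfolding rx_def ry_def by (intro sum_nonneg; simp)+
    note mx = cell_map_on_cell[OF IntD1[OF xc] IntD2[OF xc], folded rx_def]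
    note my = cell_map_on_cell[OF IntD1[OF yc] IntD2[OF yc], folded ry_def]
    have "(rx - 1) / (rx + 1) = (ry - 1) / (ry + 1)" using mx(2) my(2) eq by simp
    then have r: "rx = ry" using nn by (simp add: field_simps)
    have "dev x (e i) / depth \<alpha> N x = dev y (e i) / depth \<alpha> N y" if "i \<in> {1..N - card C}" for i
    proof -
      have "2 * (dev x (e i) / depth \<alpha> N x) / (ry + 1) = 2 * (dev y (e i) / depth \<alpha> N y) / (ry + 1)"
        using mx(3)[OF that] my(3)[OF that] eq r by simp
      moreover have "ry + 1 \<noteq> 0" using nn by simp
      ultimately show ?thesis by (simp only: divide_cancel_right mult_cancel_left) simp
    qed
    then have nl: "dev x i / depth \<alpha> N x = dev y i / depth \<alpha> N y" if "i \<in> nonleaders \<alpha> N" for i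
      using e that by (metis bij_betw_def imageE)
    have "balance \<alpha> N (\<lambda>i. (1 / depth \<alpha> N x) * dev x i) j = balance \<alpha> N (\<lambda>i. (1 / depth \<alpha> N y) * dev y i) j"
      using nl by (intro balance_cong) simp
    then show ?thesis
      unfolding balance_scale
      using dev_balanced[OF _ off_cell that] xc yc by simp
  qed
  \<comment> \<open>Evaluate at a vertex where the depth of \<open>y\<close> is attained:
    \<open>1 + ?n * dev y j\<close> equals the depth of \<open>y\<close>, and
    \<open>1 + ?n * dev x j\<close> bounds the depth of \<open>x\<close>. Proportional deviations
    turn this into an inequality between the depths; symmetry gives equality.\<close>
  have depth_le: "depth \<alpha> N x \<le> depth \<alpha> N y"
    if xc: "x \<in> conf C N \<inter> open_cell \<alpha> N" and yc: "y \<in> conf C N \<inter> open_cell \<alpha> N"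
      and sc: "\<And>j. j < N \<Longrightarrow> dev x j / depth \<alpha> N x = dev y j / depth \<alpha> N y" for x y
  proof -
    have pos: "0 < depth \<alpha> N x" "0 < depth \<alpha> N y" using xc yc depth_pos_iff[OF N] by auto
    obtain j where j: "j < N" "depth \<alpha> N y = block_size \<alpha> N (\<alpha> j) * y (\<alpha> j) j"
      using depth_attained[OF N] by blast
    let ?n = "block_size \<alpha> N (\<alpha> j)"
    have n: "0 < ?n" using block_size_ge_1[OF j(1), of \<alpha>] by simp
    have "depth \<alpha> N y = 1 + ?n * dev y j" using j n by (simp add: dev_def field_simps)
    moreover have "depth \<alpha> N x \<le> 1 + ?n * dev x j"
      using depth_le[OF j(1), of \<alpha> x] n by (simp add: dev_def field_simps)
    moreover have "dev x j = dev y j * (depth \<alpha> N x / depth \<alpha> N y)"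
      using sc[OF j(1)] pos by (simp add: field_simps)
    ultimately have "depth \<alpha> N x \<le> 1 + (depth \<alpha> N y - 1) * (depth \<alpha> N x / depth \<alpha> N y)" by simp
    then show ?thesis using pos by (simp add: field_simps)
  qed
  have d: "depth \<alpha> N x = depth \<alpha> N y"
    using depth_le[OF xc yc scaled] depth_le[OF yc xc scaled[symmetric]] by simp
  have "0 < depth \<alpha> N x" using xc depth_pos_iff[OF N] by auto
  then have "dev x j = dev y j" if "j < N" for j using scaled[OF that] d by simp
  then have "x (\<alpha> j) j = y (\<alpha> j) j" if "j < N" for j using that by (fastforce simp: dev_def)
  moreover have "x c j = y c j" if "c \<noteq> \<alpha> j \<or> N \<le> j" for c j
    using conf_open_cell_off[of x C N \<alpha> c j] conf_open_cell_off[of y C N \<alpha> c j] that xc yc by auto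
  ultimately show "x = y" by (intro ext) (metis not_le)
qed

text \<open>Project \<open>y\<close> stereographically to \<open>u\<close>, extend it to the
  balanced vector \<open>U\<close>, and look on the ray through \<open>U\<close> for the point
  \<open>barycenter + s * U\<close> whose depth is the factor \<open>s\<close> itself.\<close>

lemma cell_map_surj:
  assumes y: "y \<in> unit_sphere (N - card C)" "y \<noteq> nsphere_basepoint"
  shows "\<exists>x \<in> conf C N \<inter> open_cell \<alpha> N. cell_map x = y"
proof -
  let ?d = "N - card C"
  have sum1: "(y 0)\<^sup>2 + (\<Sum>i=1..?d. (y i)\<^sup>2) = 1"
    using y(1) unfolding unit_sphere_def sum_atMost_split by simp
  have "(y 0)\<^sup>2 \<le> 1" using sum1 sum_nonneg[of "{1..?d}" "\<lambda>i. (y i)\<^sup>2"] by simp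
  then have "y 0 \<le> 1" by (simp add: power_le_one_iff abs_square_le_1)
  then have y0: "y 0 < 1" using sphere_eq_basepoint[OF y(1)] y(2) by fastforce
  define u where "u = (\<lambda>j. y (inv_into {1..?d} e j) / (1 - y 0))"
  define U where "U = balance \<alpha> N u"
  define n where "n = (\<lambda>j. block_size \<alpha> N (\<alpha> j))"
  have n1: "1 \<le> n j" if "j < N" for j using block_size_ge_1[OF that] n_def by simp
  define M where "M = Min ((\<lambda>j. n j * U j) ` {..<N})"
  have M_le: "M \<le> n j * U j" if "j < N" for j using that by (auto simp: M_def)
  have "M \<in> (\<lambda>j. n j * U j) ` {..<N}" unfolding M_def using N by (intro Min_in) auto
  then obtain jm where jm: "jm < N" "M = n jm * U jm" by auto
  have "M \<le> 0"
  proof (rule ccontr)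
    assume "\<not> M \<le> 0"
    then have "0 < U j" if "j < N" for j
      using M_le[OF that] n1[OF that] by (smt (verit) mult_nonneg_nonpos)
    then have "0 < (\<Sum>i | i < N \<and> \<alpha> i = \<alpha> 0. U i)" using N by (intro sum_pos) auto
    then show False using sum_balance[OF N, of \<alpha> u] by (simp add: U_def)
  qed
  \<comment> \<open>The depth of \<open>barycenter + s * U\<close> is \<open>1 + s * M\<close>, so
    \<open>s = 1 + s * M\<close> has to be solved. This has a positive solution because
    \<open>M \<le> 0\<close>.\<close>
  define s where "s = 1 / (1 - M)"
  have s: "0 < s" "1 + M * s = s" using \<open>M \<le> 0\<close> by (auto simp: s_def field_simps)
  define x where "x = (\<lambda>c j. if j < N \<and> \<alpha> j = c then 1 / n j + U j * s else 0)"
  have nx: "n j * x (\<alpha> j) j = 1 + n j * U j * s" if "j < N" for j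
    using n1[OF that] that by (simp add: x_def field_simps)
  have nx_ge: "s \<le> n j * x (\<alpha> j) j" if "j < N" for j
    using mult_right_mono[OF M_le[OF that], of s] s nx[OF that] by linarith
  have depth: "depth \<alpha> N x = s"
    unfolding depth_def n_def[symmetric]
  proof (rule Min_eqI)
    show "s \<in> (\<lambda>j. block_size \<alpha> N (\<alpha> j) * x (\<alpha> j) j) ` {..<N}"
      using nx[OF jm(1)] jm s(2) by (auto simp: n_def intro!: image_eqI[of _ _ jm])
  qed (use nx_ge in \<open>auto simp: n_def\<close>)
  have pos: "0 < x (\<alpha> j) j" if "j < N" for j
    using nx_ge[OF that] s(1) n1[OF that] by (smt (verit) mult_nonneg_nonpos)
  have cell: "x \<in> open_cell \<alpha> N" using pos by (simp add: open_cell_def)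
  have sum: "(\<Sum>j<N. x c j) = 1" if c: "c \<in> C" for c
  proof -
    obtain k where k: "k < N" "\<alpha> k = c" using c \<alpha> by auto
    let ?B = "{i. i < N \<and> \<alpha> i = \<alpha> k}"
    have "(\<Sum>j<N. x c j) = (\<Sum>j<N. if \<alpha> j = c then 1 / n k + U j * s else 0)"
      using k by (intro sum.cong) (auto simp: x_def n_def)
    also have "\<dots> = (\<Sum>j\<in>?B. 1 / n k + U j * s)" unfolding sum_over_block k(2) ..
    also have "\<dots> = n k * (1 / n k) + (\<Sum>j\<in>?B. U j) * s"
      by (simp add: sum.distrib sum_distrib_right n_def block_size_def)
    also have "\<dots> = 1" using n1[OF k(1)] sum_balance[OF k(1), of \<alpha> u] by (simp add: U_def)
    finally show ?thesis .
  qed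
  have nonneg: "0 \<le> x c j" for c j using pos[of j] by (auto simp: x_def)
  have conf: "x \<in> conf C N"
    unfolding conf_def using nonneg sum \<alpha> by (auto simp: x_def)
  have dev: "dev x (e i) / depth \<alpha> N x = y i / (1 - y 0)" if "i \<in> {1..?d}" for i
  proof -
    have ei: "e i \<in> nonleaders \<alpha> N" using e that by (auto simp: bij_betw_def)
    then have "e i < N" by (simp add: nonleaders_def)
    then have "dev x (e i) = U (e i) * s" by (simp add: dev_def x_def n_def)
    moreover have "U (e i) = y i / (1 - y 0)"
      using ei e that by (simp add: U_def balance_def u_def bij_betw_def)
    ultimately show ?thesis using depth s(1) by simp
  qed
  define r where "r = (\<Sum>i=1..?d. (dev x (e i) / depth \<alpha> N x)\<^sup>2)"
  have "r = (\<Sum>i=1..?d. (y i)\<^sup>2) / (1 - y 0)\<^sup>2"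
    unfolding r_def sum_divide_distrib by (intro sum.cong) (simp_all add: dev power_divide del: One_nat_def)
  also have "\<dots> = (1 + y 0) / (1 - y 0)"
  proof -
    have "(\<Sum>i=1..?d. (y i)\<^sup>2) = (1 + y 0) * (1 - y 0)" using sum1 by (simp add: power2_eq_square algebra_simps)
    then show ?thesis using y0 by (simp add: power2_eq_square)
  qed
  finally have r1: "r + 1 = 2 / (1 - y 0)" "r - 1 = 2 * y 0 / (1 - y 0)"
    using y0 by (simp_all add: field_simps)
  note m = cell_map_on_cell[OF conf cell, folded r_def]
  have "cell_map x i = y i" for i
  proof (cases "i = 0")
    case True then show ?thesis using m(2) r1 y0 by simp
  next
    case False
    show ?thesis
    proof (cases "i \<le> ?d")
      case True
      then show ?thesis using m(3)[of i] dev[of i] False r1 y0 by simp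
    next
      case F: False
      then show ?thesis using False y(1) by (simp add: cell_map_def unit_sphere_def)
    qed
  qed
  then show ?thesis using conf cell by (intro bexI[of _ x]) auto
qed

end

lemma cell_map_exists:
  assumes "0 < N" "\<alpha> ` {..<N} = C"
  obtains f :: "(nat \<Rightarrow> nat \<Rightarrow> real) \<Rightarrow> nat \<Rightarrow> real" where
    "continuous_on (conf C N) f"
    "f \<in> conf C N - open_cell \<alpha> N \<rightarrow> {nsphere_basepoint}"
    "bij_betw f (conf C N \<inter> open_cell \<alpha> N) (unit_sphere (N - card C) - {nsphere_basepoint})"
proof -
  have "card {1..N - card C} = card (nonleaders \<alpha> N)" using card_nonleaders[of \<alpha> N] assms(2) by simp
  then obtain e where "bij_betw e {1..N - card C} (nonleaders \<alpha> N)"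
    using finite_same_card_bij[OF _ finite_nonleaders] by blast
  then have "top_cell C N \<alpha> e" using assms by (simp add: top_cell_def)
  then interpret top_cell C N \<alpha> e .
  have "cell_map ` (conf C N \<inter> open_cell \<alpha> N) = unit_sphere (N - card C) - {nsphere_basepoint}"
  proof (intro equalityI subsetI)
    fix y assume "y \<in> unit_sphere (N - card C) - {nsphere_basepoint}"
    then obtain x where "x \<in> conf C N \<inter> open_cell \<alpha> N" "cell_map x = y"
      using cell_map_surj[of y] by auto
    then show "y \<in> cell_map ` (conf C N \<inter> open_cell \<alpha> N)" by auto
  qed (use cell_map_in_sphere cell_map_neq_basepoint in auto)
  then have bij: "bij_betw cell_map (conf C N \<inter> open_cell \<alpha> N) (unit_sphere (N - card C) - {nsphere_basepoint})"
    using cell_map_inj by (simp add: bij_betw_def)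
  show ?thesis
    by (rule that[OF continuous_on_cell_map _ bij]) (use cell_map_off_cell in auto)
qed

section \<open>Identification of the given spaces\<close>

lemma nsphere_eq: "nsphere d = top_of_set (unit_sphere d)"
  by (simp add: nsphere unit_sphere_def euclidean_product_topology)

lemma compact_unit_sphere: "compact (unit_sphere d)"
proof -
  have "compactin (product_topology (\<lambda>_. euclidean) UNIV) (PiE UNIV (\<lambda>_::nat. {-1..1::real}))"
    unfolding compactin_PiE by simp
  then have 1: "compact (PiE UNIV (\<lambda>_::nat. {-1..1::real}))"
    by (simp add: euclidean_product_topology)
  have eq: "unit_sphere d = {x. (\<Sum>i\<le>d. (x i)\<^sup>2) = 1} \<inter> (\<Inter>i\<in>{d<..}. {x. x i = 0})"
    by (auto simp: unit_sphere_def)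
  have coord: "continuous_on UNIV (\<lambda>x::nat \<Rightarrow> real. x i)" for i
    by (rule continuous_on_product_coordinates)
  have 2: "closed (unit_sphere d)"
    unfolding eq
    by (intro closed_Int closed_INT ballI closed_Collect_eq continuous_on_sum continuous_on_power coord continuous_on_const)
  have "\<bar>x i\<bar> \<le> 1" if x: "x \<in> unit_sphere d" for x i
  proof (cases "i \<le> d")
    case True
    then have "(x i)\<^sup>2 \<le> (\<Sum>i\<le>d. (x i)\<^sup>2)" by (intro member_le_sum) auto
    then show ?thesis using x by (simp add: unit_sphere_def abs_square_le_1)
  qed (use x in \<open>simp add: unit_sphere_def\<close>)
  then have "unit_sphere d \<subseteq> PiE UNIV (\<lambda>_. {-1..1})" by (auto simp: abs_le_iff)
  then show ?thesis
    using compact_Int_closed[OF 1 2] by (metis inf.absorb_iff2)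
qed

section \<open>The wedge as a subspace of a product of spheres\<close>

lemma continuous_map_from_sum_topology:
  assumes "\<And>i. i \<in> I \<Longrightarrow> continuous_map (X i) Y (\<lambda>x. f (i, x))"
  shows "continuous_map (sum_topology X I) Y f"
proof -
  have "f (i, x) \<in> topspace Y" if "i \<in> I" "x \<in> topspace (X i)" for i x
    using assms[OF that(1)] that(2) by (auto simp: continuous_map_def)
  moreover have "openin (X i) {x. i \<in> I \<and> x \<in> topspace (X i) \<and> f (i, x) \<in> U}"
    if "i \<in> I" "openin Y U" for i U
    using assms[OF that(1)] that by (simp add: continuous_map_def)
  ultimately show ?thesis
    by (auto simp: continuous_map_def openin_sum_topology)
qed

lemma compact_space_sum_topology:
  assumes "finite I" "\<And>i. i \<in> I \<Longrightarrow> compact_space (X i)"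
  shows "compact_space (sum_topology X I)"
proof -
  have "compactin (sum_topology X I) (Pair i ` topspace (X i))" if "i \<in> I" for i
    using that assms(2) continuous_map_component_injection[OF that, of X]
    by (intro image_compactin[of "X i"]) (auto simp: compact_space_def)
  then have "compactin (sum_topology X I) (\<Union>i\<in>I. Pair i ` topspace (X i))"
    using assms(1) by (intro compactin_Union) auto
  moreover have "(\<Union>i\<in>I. Pair i ` topspace (X i)) = topspace (sum_topology X I)" by auto
  ultimately show ?thesis by (simp add: compact_space_def)
qed

lemma homeomorphic_space_quotients:
  assumes f: "quotient_map X Y f" and g: "quotient_map X Z g"
    and eq: "\<And>x y. x \<in> topspace X \<Longrightarrow> y \<in> topspace X \<Longrightarrow> f x = f y \<longleftrightarrow> g x = g y"
  shows "Y homeomorphic_space Z"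
proof -
  obtain h where h: "continuous_map Y Z h" "\<And>x. x \<in> topspace X \<Longrightarrow> h (f x) = g x"
    using quotient_map_lift_exists[OF f quotient_imp_continuous_map[OF g]] eq by metis
  obtain k where k: "continuous_map Z Y k" "\<And>x. x \<in> topspace X \<Longrightarrow> k (g x) = f x"
    using quotient_map_lift_exists[OF g quotient_imp_continuous_map[OF f]] eq by metis
  have "topspace Y = f ` topspace X" "topspace Z = g ` topspace X"
    using f g by (simp_all add: quotient_map_def)
  then show ?thesis
    unfolding homeomorphic_space_def homeomorphic_maps_def
    by (intro exI[of _ h] exI[of _ k]) (use h k in auto)
qed

text \<open>The wedge as the set of points with at most one coordinate away from the basepoint. In
  this form it lies in a metric space, and maps into it can be given coordinate by coordinate. It is
  empty for \<open>m = 0\<close>.\<close>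

definition bouquet :: "nat \<Rightarrow> nat \<Rightarrow> (nat \<Rightarrow> nat \<Rightarrow> real) set" where
  "bouquet m d = {(\<lambda>_. nsphere_basepoint)(i := y) | i y. i \<in> {1..m} \<and> y \<in> unit_sphere d}"

text \<open>The disjoint union is compact and the bouquet is Hausdorff, so \<open>f\<close> is a
  quotient map. It has the same fibres as the map \<open>q\<close> that defines the wedge.\<close>

lemma wedge_of_spheres_homeomorphic:
  "wedge_of_spheres m d homeomorphic_space top_of_set (bouquet m d)"
proof -
  let ?X = "sum_topology (\<lambda>_. nsphere d) {1..m}"
  let ?b = "\<lambda>i::nat. (i, nsphere_basepoint)"
  define q where "q = (\<lambda>z::nat \<times> (nat \<Rightarrow> real). if z \<in> ?b ` {1..m} then ?b ` {1..m} else {z})"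
  define f where "f = (\<lambda>z::nat \<times> (nat \<Rightarrow> real). (\<lambda>_. nsphere_basepoint)(fst z := snd z))"
  have top: "topspace ?X = {1..m} \<times> unit_sphere d" by (auto simp: nsphere_eq)
  have q: "quotient_map ?X (wedge_of_spheres m d) q"
    unfolding wedge_of_spheres_def wedge_sum_def q_def by (rule quotient_map_quotient_topology)
  have "continuous_map ?X (top_of_set (bouquet m d)) f"
  proof (rule continuous_map_from_sum_topology)
    fix i assume "i \<in> {1..m}"
    have "continuous_on (unit_sphere d) (\<lambda>y. f (i, y))"
    proof (rule continuous_on_coordinatewise_then_product)
      fix j show "continuous_on (unit_sphere d) (\<lambda>y. f (i, y) j)"
        by (cases "j = i") (simp_all add: f_def continuous_on_id continuous_on_const)
    qed
    then show "continuous_map (nsphere d) (top_of_set (bouquet m d)) (\<lambda>y. f (i, y))"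
      using \<open>i \<in> {1..m}\<close> by (auto simp: nsphere_eq f_def bouquet_def)
  qed
  moreover have "compact_space ?X"
    by (intro compact_space_sum_topology) (auto simp: nsphere_eq compact_space_subtopology compact_unit_sphere)
  moreover have "f ` topspace ?X = topspace (top_of_set (bouquet m d))"
    unfolding top by (force simp: f_def bouquet_def)
  ultimately have "quotient_map ?X (top_of_set (bouquet m d)) f"
    by (intro continuous_imp_quotient_map Hausdorff_space_subtopology Hausdorff_space_euclidean)
  moreover have "q x = q y \<longleftrightarrow> f x = f y" if "x \<in> topspace ?X" "y \<in> topspace ?X" for x y
  proof -
    obtain i u j v where xy: "x = (i, u)" "y = (j, v)" by (cases x; cases y)
    have ij: "i \<in> {1..m}" "j \<in> {1..m}" using that xy by auto
    have fb: "f (i, nsphere_basepoint) = (\<lambda>_. nsphere_basepoint)" for i by (auto simp: f_def)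
    have fi: "f (i, u) i = u" for i u by (simp add: f_def)
    have fo: "l \<noteq> i \<Longrightarrow> f (i, u) l = nsphere_basepoint" for i u l by (simp add: f_def)
    show ?thesis
    proof (cases "u = nsphere_basepoint"; cases "v = nsphere_basepoint")
      assume "u = nsphere_basepoint" "v = nsphere_basepoint"
      then show ?thesis using xy ij fb by (auto simp: q_def)
    next
      assume A: "u = nsphere_basepoint" "v \<noteq> nsphere_basepoint"
      then have "f (i, u) \<noteq> f (j, v)" using fb[of i] fi[of j v] by (metis (full_types))
      moreover have "q x \<noteq> q y" using A xy ij by (auto simp: q_def)
      ultimately show ?thesis using xy by simp
    next
      assume A: "u \<noteq> nsphere_basepoint" "v = nsphere_basepoint"
      then have "f (i, u) \<noteq> f (j, v)" using fb[of j] fi[of i u] by (metis (full_types))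
      moreover have "q x \<noteq> q y" using A xy ij by (auto simp: q_def)
      ultimately show ?thesis using xy by simp
    next
      assume A: "u \<noteq> nsphere_basepoint" "v \<noteq> nsphere_basepoint"
      then have "f (i, u) = f (j, v) \<longleftrightarrow> (i, u) = (j, v)" using fi fo by metis
      moreover have "q x = q y \<longleftrightarrow> (i, u) = (j, v)" using A xy by (auto simp: q_def)
      ultimately show ?thesis using xy by simp
    qed
  qed
  ultimately show ?thesis using homeomorphic_space_quotients[OF q] by blast
qed

section \<open>From open faces with disjoint closures to rows with disjoint supports\<close>

lemma simplex_space_eq: "simplex_space n = top_of_set (standard_simplex n)"
  by (simp add: simplex_space_def euclidean_product_topology)

lemma closure_of_open_face_subset:
  "simplex_space n closure_of open_face n S \<subseteq> {x \<in> standard_simplex n. \<forall>i. i \<notin> S \<longrightarrow> x i = 0}"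
proof (rule closure_of_minimal)
  have "closed (\<Inter>i\<in>-S. {x::nat \<Rightarrow> real. x i = 0})"
    by (intro closed_INT ballI closed_Collect_eq continuous_on_const continuous_on_product_coordinates)
  then have "closedin (simplex_space n) (standard_simplex n \<inter> (\<Inter>i\<in>-S. {x. x i = 0}))"
    unfolding simplex_space_eq by (rule closedin_closed_Int)
  then show "closedin (simplex_space n) {x \<in> standard_simplex n. \<forall>i. i \<notin> S \<longrightarrow> x i = 0}"
    by (rule back_subst[of "closedin _"]) auto
qed (auto simp: open_face_def)

lemma vertex_in_closure_of_open_face:
  assumes S: "S \<subseteq> {0..n}" and j: "j \<in> S"
  shows "(\<lambda>i. if i = j then 1 else 0) \<in> simplex_space n closure_of open_face n S"
proof -
  define e where "e = (\<lambda>i. if i = j then 1 else (0::real))"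
  define b where "b = (\<lambda>i. if i \<in> S then 1 / real (card S) else 0)"
  have fin: "finite S" using S finite_subset by blast
  then have card: "0 < card S" using j card_gt_0_iff by blast
  have jn: "j \<le> n" using S j by auto
  \<comment> \<open>The segment from the vertex to the barycenter of the face; it runs inside the
    open face except possibly at its ends, so its start is a limit point.\<close>
  define g where "g = (\<lambda>t::real. (\<lambda>i. (1 - t) * e i + t * b i))"
  have "(\<Sum>i\<le>n. b i) = (\<Sum>i\<in>S. 1 / real (card S))"
    unfolding b_def using S by (intro sum.mono_neutral_cong_right) auto
  then have sum_b: "(\<Sum>i\<le>n. b i) = 1" using card by simp
  have sum_e: "(\<Sum>i\<le>n. e i) = 1" using jn by (simp add: e_def)
  have "g t \<in> open_face n S" if t: "t \<in> {0<..<1}" for t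
  proof -
    have "(\<Sum>i\<le>n. g t i) = 1"
      unfolding g_def sum.distrib sum_distrib_left[symmetric] sum_b sum_e by simp
    moreover have nn: "0 \<le> g t i" for i using t by (auto simp: g_def e_def b_def)
    moreover have "g t i \<le> 1" for i
    proof -
      have "b i \<le> 1" "e i \<le> 1" using card by (auto simp: b_def e_def field_simps)
      then have "(1 - t) * e i + t * b i \<le> (1 - t) * 1 + t * 1"
        using t by (intro add_mono mult_left_mono) auto
      then show ?thesis by (simp add: g_def)
    qed
    moreover have "g t i = 0" if "n < i" for i using that S jn by (auto simp: g_def e_def b_def)
    ultimately have "g t \<in> standard_simplex n" by (simp add: standard_simplex_def)
    moreover have "g t i \<noteq> 0 \<longleftrightarrow> i \<in> S" for i
    proof (cases "i \<in> S")
      case True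
      then have "0 < t * b i" "0 \<le> (1 - t) * e i" using t card by (auto simp: b_def e_def)
      then have "0 < g t i" unfolding g_def by linarith
      then show ?thesis using True by simp
    qed (use j in \<open>auto simp: g_def b_def e_def\<close>)
    ultimately show ?thesis by (auto simp: open_face_def)
  qed
  then have "g ` {0<..<1} \<subseteq> closure (open_face n S)" using closure_subset by blast
  moreover have "continuous_on (closure {0<..<1}) g"
    unfolding g_def by (intro continuous_on_coordinatewise_then_product continuous_intros)
  ultimately have "g ` closure {0<..<1} \<subseteq> closure (open_face n S)"
    by (intro image_closure_subset) auto
  then have "g 0 \<in> closure (open_face n S)" by auto
  then have "e \<in> closure (open_face n S)" by (simp add: g_def)
  moreover have "open_face n S \<subseteq> standard_simplex n" by (auto simp: open_face_def)
  moreover have "e \<in> standard_simplex n" unfolding e_def using jn by simp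
  ultimately have "e \<in> simplex_space n closure_of open_face n S"
    unfolding simplex_space_eq by (simp add: closure_of_subtopology Int_absorb1)
  then show ?thesis by (simp add: e_def)
qed

lemma disjnt_closure_of_open_faces:
  assumes S: "S \<subseteq> {0..n}" and T: "T \<subseteq> {0..n}"
  shows "disjnt (simplex_space n closure_of open_face n S) (simplex_space n closure_of open_face n T)
    \<longleftrightarrow> S \<inter> T = {}"
proof
  assume "disjnt (simplex_space n closure_of open_face n S) (simplex_space n closure_of open_face n T)"
  then show "S \<inter> T = {}"
    using vertex_in_closure_of_open_face[OF S] vertex_in_closure_of_open_face[OF T]
    unfolding disjnt_def by blast
next
  assume ST: "S \<inter> T = {}"
  have False if "x \<in> simplex_space n closure_of open_face n S" "x \<in> simplex_space n closure_of open_face n T" for x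
  proof -
    have "x \<in> standard_simplex n" "\<And>i. i \<notin> S \<Longrightarrow> x i = 0" "\<And>i. i \<notin> T \<Longrightarrow> x i = 0"
      using that closure_of_open_face_subset by blast+
    then have "x i = 0" for i using ST by (cases "i \<in> S") auto
    then have "(\<Sum>i\<le>n. x i) = 0" by simp
    then show False using \<open>x \<in> standard_simplex n\<close> by (simp add: standard_simplex_def)
  qed
  then show "disjnt (simplex_space n closure_of open_face n S) (simplex_space n closure_of open_face n T)"
    unfolding disjnt_def by blast
qed

lemma configuration_cells_eq:
  "\<Union>{\<Pi>\<^sub>E i\<in>{1..k}. \<sigma> i | \<sigma>.
      (\<forall>i\<in>{1..k}. \<sigma> i \<in> open_cells n) \<and>
      pairwise (\<lambda>i j. disjnt (simplex_space n closure_of \<sigma> i) (simplex_space n closure_of \<sigma> j)) {1..k}}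
   = {x \<in> extensional {1..k}. (\<forall>i\<in>{1..k}. x i \<in> standard_simplex n) \<and>
       pairwise (\<lambda>i j. \<forall>l. x i l = 0 \<or> x j l = 0) {1..k}}" (is "\<Union>?\<S> = ?R")
proof (intro equalityI subsetI)
  fix x assume "x \<in> \<Union>?\<S>"
  then obtain \<sigma> where x: "x \<in> (\<Pi>\<^sub>E i\<in>{1..k}. \<sigma> i)"
    and \<sigma>: "\<And>i. i \<in> {1..k} \<Longrightarrow> \<sigma> i \<in> open_cells n"
    and disj: "pairwise (\<lambda>i j. disjnt (simplex_space n closure_of \<sigma> i) (simplex_space n closure_of \<sigma> j)) {1..k}"
    by blast
  have "\<exists>S. S \<subseteq> {0..n} \<and> \<sigma> i = open_face n S" if "i \<in> {1..k}" for i
    using \<sigma>[OF that] by (auto simp: open_cells_def)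
  then obtain S where S: "\<And>i. i \<in> {1..k} \<Longrightarrow> S i \<subseteq> {0..n} \<and> \<sigma> i = open_face n (S i)" by metis
  have xi: "x i \<in> standard_simplex n \<and> {l. x i l \<noteq> 0} = S i" if "i \<in> {1..k}" for i
    using PiE_mem[OF x that] S[OF that] by (auto simp: open_face_def)
  have "x i l = 0 \<or> x j l = 0" if "i \<in> {1..k}" "j \<in> {1..k}" "i \<noteq> j" for i j l
  proof -
    have "S i \<inter> S j = {}"
      using pairwiseD[OF disj that] S[OF that(1)] S[OF that(2)] disjnt_closure_of_open_faces by metis
    then show ?thesis using xi[OF that(1)] xi[OF that(2)] by blast
  qed
  then show "x \<in> ?R" using x xi by (auto simp: PiE_def pairwise_def)
next
  fix x assume x: "x \<in> ?R"
  define S where "S = (\<lambda>i. {l. x i l \<noteq> 0})"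
  have S: "S i \<subseteq> {0..n}" "S i \<noteq> {}" if "i \<in> {1..k}" for i
  proof -
    have xi: "x i \<in> standard_simplex n" using x that by blast
    then show "S i \<subseteq> {0..n}" by (force simp: S_def standard_simplex_def not_less[symmetric])
    show "S i \<noteq> {}"
    proof
      assume "S i = {}"
      then have "(\<Sum>l\<le>n. x i l) = 0" by (auto simp: S_def)
      then show False using xi by (simp add: standard_simplex_def)
    qed
  qed
  have "x \<in> (\<Pi>\<^sub>E i\<in>{1..k}. open_face n (S i))"
    using x by (auto simp: open_face_def S_def PiE_def)
  moreover have "\<forall>i\<in>{1..k}. open_face n (S i) \<in> open_cells n" using S by (auto simp: open_cells_def)
  moreover have "pairwise (\<lambda>i j. disjnt (simplex_space n closure_of open_face n (S i))
      (simplex_space n closure_of open_face n (S j))) {1..k}"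
    unfolding pairwise_def
  proof (intro ballI impI)
    fix i j assume ij: "i \<in> {1..k}" "j \<in> {1..k}" "i \<noteq> j"
    have "pairwise (\<lambda>i j. \<forall>l. x i l = 0 \<or> x j l = 0) {1..k}" using x by simp
    then have "\<forall>l. x i l = 0 \<or> x j l = 0" using ij by (rule pairwiseD)
    then have "S i \<inter> S j = {}" by (auto simp: S_def)
    then show "disjnt (simplex_space n closure_of open_face n (S i)) (simplex_space n closure_of open_face n (S j))"
      using disjnt_closure_of_open_faces S(1)[OF ij(1)] S(1)[OF ij(2)] by blast
  qed
  ultimately show "x \<in> \<Union>?\<S>"
    by (intro UnionI[of "\<Pi>\<^sub>E i\<in>{1..k}. open_face n (S i)"] CollectI
        exI[of _ "\<lambda>i. open_face n (S i)"] conjI refl)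
qed

text \<open>Only the convention for rows outside \<open>{1..k}\<close> differs:
  \<open>undefined\<close> on one side, zero on the other. The vertices \<open>0, ..., n\<close>
  become the \<open>Suc n\<close> columns.\<close>

lemma discretized_configuration_space_homeomorphic:
  "discretized_configuration_space k n homeomorphic_space top_of_set (conf {1..k} (Suc n))"
proof -
  let ?I = "{1..k}"
  define U where "U = {x \<in> extensional ?I. (\<forall>i\<in>?I. x i \<in> standard_simplex n) \<and>
       pairwise (\<lambda>i j. \<forall>l. x i l = 0 \<or> x j l = 0) ?I}"
  let ?P = "product_topology (\<lambda>_. simplex_space n) ?I"
  have X: "discretized_configuration_space k n = subtopology ?P U"
    unfolding discretized_configuration_space_def configuration_cells_eq U_def ..
  have top: "topspace (subtopology ?P U) = U"
    by (auto simp: simplex_space_eq U_def PiE_def)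
  define f where "f = (\<lambda>(x::nat \<Rightarrow> nat \<Rightarrow> real) c j. if c \<in> ?I then x c j else 0)"
  have fU: "f x \<in> conf ?I (Suc n)" if "x \<in> U" for x
    using that unfolding conf_def U_def f_def
    by (auto simp: standard_simplex_def lessThan_Suc_atMost pairwise_def Suc_le_eq)
  have rU: "restrict y ?I \<in> U" if y: "y \<in> conf ?I (Suc n)" for y
    using confD[OF y] conf_le_1[OF y] unfolding U_def
    by (auto simp: standard_simplex_def lessThan_Suc_atMost pairwise_def Suc_le_eq)
  have "continuous_map (subtopology ?P U) euclidean f"
    unfolding euclidean_product_topology[symmetric] continuous_map_componentwise_UNIV
  proof (intro allI)
    fix c j
    show "continuous_map (subtopology ?P U) euclideanreal (\<lambda>x. f x c j)"
    proof (cases "c \<in> ?I")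
      case True
      have "continuous_map ?P (simplex_space n) (\<lambda>x. x c)"
        using True by (rule continuous_map_product_projection)
      moreover have "continuous_map (simplex_space n) euclideanreal (\<lambda>y. y j)"
        unfolding simplex_space_def
        by (intro continuous_map_from_subtopology continuous_map_product_projection) simp
      ultimately have "continuous_map (subtopology ?P U) euclideanreal (\<lambda>x. x c j)"
        using continuous_map_compose[of ?P "simplex_space n" "\<lambda>x. x c" euclideanreal "\<lambda>y. y j"]
        by (simp add: o_def continuous_map_from_subtopology)
      then show ?thesis using True by (simp add: f_def)
    next
      case False
      then have "(\<lambda>x. f x c j) = (\<lambda>_. 0)" by (auto simp: f_def fun_eq_iff)
      then show ?thesis by simp
    qed
  qed
  then have "continuous_map (subtopology ?P U) (top_of_set (conf ?I (Suc n))) f"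
    using fU top by (auto simp: continuous_map_in_subtopology)
  moreover have "continuous_map (top_of_set (conf ?I (Suc n))) (subtopology ?P U) (\<lambda>y. restrict y ?I)"
  proof -
    have "continuous_map (top_of_set (conf ?I (Suc n))) (simplex_space n) (\<lambda>y. restrict y ?I c)" if "c \<in> ?I" for c
    proof -
      have "continuous_on (conf ?I (Suc n)) (\<lambda>y. y c)"
        by (rule continuous_on_product_then_coordinatewise[OF continuous_on_id])
      moreover have "y c \<in> standard_simplex n" if "y \<in> conf ?I (Suc n)" for y
        using rU[OF that] \<open>c \<in> ?I\<close> by (simp add: U_def)
      ultimately show ?thesis using that by (auto simp: simplex_space_eq)
    qed
    then have "continuous_map (top_of_set (conf ?I (Suc n))) ?P (\<lambda>y. restrict y ?I)"
      by (auto simp: continuous_map_componentwise)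
    then show ?thesis using rU by (auto simp: continuous_map_in_subtopology)
  qed
  moreover have "restrict (f x) ?I = x" if "x \<in> U" for x
    using that by (auto simp: U_def f_def fun_eq_iff extensional_def)
  moreover have "f (restrict y ?I) = y" if "y \<in> conf ?I (Suc n)" for y
    using confD(2)[OF that] by (auto simp: f_def fun_eq_iff)
  ultimately show ?thesis
    unfolding homeomorphic_space_def homeomorphic_maps_def X
    by (intro exI[of _ f] exI[of _ "\<lambda>y. restrict y ?I"]) (use top in auto)
qed

section \<open>Collapsing the core\<close>

text \<open>This provides the bound \<open>1 \<le> m\<close>. Two colours supply some
  \<open>c \<noteq> Min C\<close>; a word without repetitions headed by \<open>c\<close> is removed,
  and prepending further copies of \<open>c\<close> keeps it removed.\<close>

lemma removed_word_exists:
  assumes "finite C" "2 \<le> card C" "card C \<le> N"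
  shows "removed_words C N \<noteq> {}"
  using assms(3)
proof (induction N rule: dec_induct)
  case base
  have "\<not> C \<subseteq> {Min C}" using assms(2) card_mono[of "{Min C}" C] by auto
  then obtain c where c: "c \<in> C" "c \<noteq> Min C" by blast
  obtain v where v: "set v = C - {c}" "distinct v"
    using finite_distinct_list[of "C - {c}"] assms(1) by auto
  have C: "set (c # v) = C" using v c by auto
  moreover have "length (c # v) = card C" using distinct_card[of "c # v"] v C by simp
  moreover have "removed (c # v)" using v c C by auto
  ultimately have "c # v \<in> removed_words C (card C)" by (simp add: removed_words_def)
  then show ?case by blast
next
  case (step N)
  then obtain w where w: "w \<in> removed_words C N" by blast
  have "\<not> C \<subseteq> {Min C}" using assms(2) card_mono[of "{Min C}" C] by auto
  then obtain c where c: "c \<in> C" "c \<noteq> Min C" by blast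
  then have "c # w \<in> removed_words C (Suc N)" using w by (auto simp: removed_words_def insert_absorb)
  then show ?case by blast
qed

lemma finite_removed_words: "finite C \<Longrightarrow> finite (removed_words C N)"
  by (rule finite_subset[OF _ finite_lists_length_eq[of C N]]) (auto simp: removed_words_def)

lemma word_range: "w \<in> removed_words C N \<Longrightarrow> (!) (rev w) ` {..<N} = C"
  using nth_image[of "length w" "rev w"] by (auto simp: removed_words_def lessThan_atLeast0)

lemma word_eqI:
  assumes "v \<in> removed_words C N" "w \<in> removed_words C N" "\<forall>j<N. rev v ! j = rev w ! j"
  shows "v = w"
  using assms nth_equalityI[of "rev v" "rev w"] by (simp add: removed_words_def)

text \<open>The collapsing map has one coordinate for each removed cell, namely its cell map.
  Different cells are disjoint, so at most one coordinate leaves the basepoint, and none does on the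
  core. The extra singleton accounts for the case without removed cells, where the bouquet is empty
  but the configuration space is contractible.\<close>

lemma conf_homotopy_equivalent_bouquet:
  assumes C: "finite C" "C \<noteq> {}" "card C \<le> N"
  shows "top_of_set (conf C N) homotopy_equivalent_space
    top_of_set (bouquet (card (removed_words C N)) (N - card C) \<union> {\<lambda>_. nsphere_basepoint})"
proof -
  let ?R = "removed_words C N" and ?d = "N - card C" and ?b = nsphere_basepoint
  let ?cell = "\<lambda>w. open_cell ((!) (rev w)) N"
  define m where "m = card ?R"
  have N: "0 < N" using C by (metis card_gt_0_iff gr0I le_zero_eq)
  have core: "core C N = conf C N - (\<Union>\<alpha>\<in>(\<lambda>w. (!) (rev w)) ` ?R. open_cell \<alpha> N)"
    by (auto simp: core_def removed_words_def)
  have hep: "hep (conf C N) (core C N)"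
    unfolding core
  proof (rule hep_remove_cells[OF N])
    show "finite ((\<lambda>w. (!) (rev w)) ` ?R)" using finite_removed_words[OF C(1)] by simp
    show "\<alpha> ` {..<N} = C" if "\<alpha> \<in> (\<lambda>w. (!) (rev w)) ` ?R" for \<alpha>
      using that word_range by blast
    show "\<alpha> = \<beta>" if "\<alpha> \<in> (\<lambda>w. (!) (rev w)) ` ?R" "\<beta> \<in> (\<lambda>w. (!) (rev w)) ` ?R" "\<forall>j<N. \<alpha> j = \<beta> j" for \<alpha> \<beta>
      using that word_eqI by blast
  qed
  obtain w where w: "bij_betw w {1..m} ?R"
    using finite_same_card_bij[of "{1..m}" ?R] finite_removed_words[OF C(1)] m_def by auto
  have wR: "w i \<in> ?R" if "i \<in> {1..m}" for i using w that by (auto simp: bij_betw_def)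
  have "\<exists>f. continuous_on (conf C N) f \<and> f \<in> conf C N - ?cell (w i) \<rightarrow> {?b} \<and>
      bij_betw f (conf C N \<inter> ?cell (w i)) (unit_sphere ?d - {?b})" if "i \<in> {1..m}" for i
    using cell_map_exists[OF N word_range[OF wR[OF that]]] by metis
  then obtain F where F: "\<And>i. i \<in> {1..m} \<Longrightarrow> continuous_on (conf C N) (F i)"
      "\<And>i. i \<in> {1..m} \<Longrightarrow> F i \<in> conf C N - ?cell (w i) \<rightarrow> {?b}"
      "\<And>i. i \<in> {1..m} \<Longrightarrow> bij_betw (F i) (conf C N \<inter> ?cell (w i)) (unit_sphere ?d - {?b})"
    by metis
  define f where "f = (\<lambda>x i. if i \<in> {1..m} then F i x else ?b)"
  have cell_unique: "i = j" if "x \<in> conf C N" "x \<in> ?cell (w i)" "x \<in> ?cell (w j)" "i \<in> {1..m}" "j \<in> {1..m}" for x i j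
  proof -
    have "\<forall>l<N. rev (w i) ! l = rev (w j) ! l" using open_cell_unique[OF that(1-3)] by blast
    then have "w i = w j" using word_eqI wR that(4,5) by blast
    then show ?thesis by (rule inj_onD[OF bij_betw_imp_inj_on[OF w] _ that(4,5)])
  qed
  have f_core: "f x = (\<lambda>_. ?b)" if "x \<in> core C N" for x
  proof
    fix i
    have "x \<in> conf C N - ?cell (w i)" if "i \<in> {1..m}"
      using \<open>x \<in> core C N\<close> wR[OF that] unfolding core by blast
    then show "f x i = ?b" using F(2)[of i] by (auto simp: f_def)
  qed
  have f_cell: "f x = (\<lambda>_. ?b)(i := F i x) \<and> F i x \<in> unit_sphere ?d - {?b}"
    if x: "x \<in> conf C N" "x \<in> ?cell (w i)" "i \<in> {1..m}" for x i
  proof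
    show "F i x \<in> unit_sphere ?d - {?b}" using bij_betw_apply[OF F(3)[OF x(3)]] x by blast
    have "F j x = ?b" if "j \<in> {1..m}" "j \<noteq> i" for j
    proof -
      have "x \<notin> ?cell (w j)" using cell_unique[OF x(1,2)] that x(3) by blast
      then show ?thesis using F(2)[OF that(1)] x(1) by auto
    qed
    then show "f x = (\<lambda>_. ?b)(i := F i x)" using x(3) by (auto simp: f_def)
  qed
  have core_or_cell: "x \<in> core C N \<or> (\<exists>i\<in>{1..m}. x \<in> ?cell (w i))" if "x \<in> conf C N" for x
  proof (rule disjCI)
    assume *: "\<not> (\<exists>i\<in>{1..m}. x \<in> ?cell (w i))"
    have "x \<notin> ?cell v" if "v \<in> ?R" for v
    proof -
      have "v \<in> w ` {1..m}" using that bij_betw_imp_surj_on[OF w] by simp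
      then show ?thesis using * by blast
    qed
    then show "x \<in> core C N" unfolding core using that by blast
  qed
  have fcont: "continuous_on (conf C N) f"
  proof (rule continuous_on_coordinatewise_then_product)
    fix i show "continuous_on (conf C N) (\<lambda>x. f x i)"
      unfolding f_def using F(1)[of i]
      by (cases "i \<in> {1..m}") (simp_all only: if_True if_False continuous_on_const)
  qed
  have feq: "f x = f y \<longleftrightarrow> x = y \<or> x \<in> core C N \<and> y \<in> core C N"
    if xy: "x \<in> conf C N" "y \<in> conf C N" for x y
  proof (cases "x \<in> core C N"; cases "y \<in> core C N")
    assume A: "x \<in> core C N" "y \<notin> core C N"
    then obtain i where i: "i \<in> {1..m}" "y \<in> ?cell (w i)" using core_or_cell[OF xy(2)] by blast
    have "f y i \<noteq> ?b" using f_cell[OF xy(2) i(2,1)] by simp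
    moreover have "f x i = ?b" using f_core[OF A(1)] by simp
    ultimately have "f x \<noteq> f y" by metis
    then show ?thesis using A by blast
  next
    assume A: "x \<notin> core C N" "y \<in> core C N"
    then obtain i where i: "i \<in> {1..m}" "x \<in> ?cell (w i)" using core_or_cell[OF xy(1)] by blast
    have "f x i \<noteq> ?b" using f_cell[OF xy(1) i(2,1)] by simp
    moreover have "f y i = ?b" using f_core[OF A(2)] by simp
    ultimately have "f x \<noteq> f y" by metis
    then show ?thesis using A by blast
  next
    assume A: "x \<notin> core C N" "y \<notin> core C N"
    obtain i where i: "i \<in> {1..m}" "x \<in> ?cell (w i)" using core_or_cell[OF xy(1)] A by blast
    obtain j where j: "j \<in> {1..m}" "y \<in> ?cell (w j)" using core_or_cell[OF xy(2)] A by blast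
    have "x = y" if "f x = f y"
    proof -
      have fi: "f x i = F i x" "F i x \<noteq> ?b" using f_cell[OF xy(1) i(2,1)] by simp_all
      have "i = j"
      proof (rule ccontr)
        assume "i \<noteq> j"
        then have "f y i = ?b" using f_cell[OF xy(2) j(2,1)] by simp
        then show False using fi that by simp
      qed
      then have "F i x = F i y" using fi(1) that f_cell[OF xy(2) j(2,1)] by simp
      then show ?thesis
        using bij_betw_imp_inj_on[OF F(3)[OF i(1)]] xy i j \<open>i = j\<close> by (auto dest: inj_onD)
    qed
    then show ?thesis using A by auto
  qed (use f_core in simp)
  have "top_of_set (conf C N) homotopy_equivalent_space top_of_set (f ` conf C N)"
    using homotopy_equivalent_collapse[OF compact_conf closed_core hep _ _ fcont feq]
      core_contractible[OF C(1,3)] by simp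
  moreover have "f ` conf C N = bouquet m ?d \<union> {\<lambda>_. ?b}"
  proof (intro equalityI subsetI)
    fix z assume "z \<in> f ` conf C N"
    then obtain x where x: "x \<in> conf C N" "z = f x" by blast
    show "z \<in> bouquet m ?d \<union> {\<lambda>_. ?b}"
    proof (cases "x \<in> core C N")
      case False
      then obtain i where i: "i \<in> {1..m}" "x \<in> ?cell (w i)" using core_or_cell[OF x(1)] by blast
      then show ?thesis using f_cell[OF x(1) i(2,1)] x(2) unfolding bouquet_def by blast
    qed (use f_core x in auto)
  next
    fix z assume z: "z \<in> bouquet m ?d \<union> {\<lambda>_. ?b}"
    show "z \<in> f ` conf C N"
    proof (cases "z = (\<lambda>_. ?b)")
      case True
      obtain x where "x \<in> core C N" using core_contractible[OF C(1,3)] by blast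
      then show ?thesis
        using True f_core[of x] by (intro image_eqI[of _ _ x]) (auto simp: core_def)
    next
      case False
      then obtain i y where iy: "i \<in> {1..m}" "y \<in> unit_sphere ?d" "z = (\<lambda>_. ?b)(i := y)"
        using z unfolding bouquet_def by blast
      have "y \<noteq> ?b" using False iy(3) by auto
      then obtain x where "x \<in> conf C N \<inter> ?cell (w i)" "F i x = y"
        using iy(2) F(3)[OF iy(1)] by (metis DiffI bij_betw_def imageE singletonD)
      then show ?thesis using f_cell[of x i] iy by (intro image_eqI[of _ _ x]) auto
    qed
  qed
  ultimately show ?thesis by (simp add: m_def)
qed

theorem theorem1p1:
  fixes n k :: nat
  assumes "1 \<le> n" and "2 \<le> k" and "k \<le> n + 1"
  shows "\<exists>m\<ge>1. discretized_configuration_space k n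
                 homotopy_equivalent_space wedge_of_spheres m (n + 1 - k)"
proof -
  define m where "m = card (removed_words {1..k} (Suc n))"
  have "1 \<le> m"
    using removed_word_exists[of "{1..k}" "Suc n"] finite_removed_words[of "{1..k}" "Suc n"] assms
    by (simp add: m_def Suc_le_eq card_gt_0_iff)
  \<comment> \<open>With at least one sphere, the common basepoint already belongs to the bouquet
    and the extra singleton is absorbed.\<close>
  then have "(\<lambda>_. nsphere_basepoint) \<in> bouquet m (n + 1 - k)"
    unfolding bouquet_def using nsphere_basepoint_in_sphere by force
  then have "top_of_set (conf {1..k} (Suc n)) homotopy_equivalent_space top_of_set (bouquet m (n + 1 - k))"
    using conf_homotopy_equivalent_bouquet[of "{1..k}" "Suc n"] assms by (simp add: m_def insert_absorb)
  moreover have "top_of_set (bouquet m (n + 1 - k)) homotopy_equivalent_space wedge_of_spheres m (n + 1 - k)"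
    using wedge_of_spheres_homeomorphic homeomorphic_space_sym homeomorphic_imp_homotopy_equivalent_space by blast
  ultimately have "discretized_configuration_space k n homotopy_equivalent_space wedge_of_spheres m (n + 1 - k)"
    using homeomorphic_imp_homotopy_equivalent_space[OF discretized_configuration_space_homeomorphic]
      homotopy_eqv_trans by blast
  then show ?thesis using \<open>1 \<le> m\<close> by blast
qed

end
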